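(* Let $1<p<N$, let $E\subset\mathbb{C}^{N}$ be a vector space of dimension $p$, and let $\phi$ be the determinantal process on $\{1,\dots,N\}$ associated to $E$ (that is, $\phi=\phi(\mathfrak{Z})$ for any orthonormal basis $\mathfrak{Z}$ of $E$), with $\phi^{c}=\{1,\dots,N\}\setminus\phi$. Let $J=\{x_{1},\dots,x_{n}\}\subset\{1,\dots,N\}$ be a set of $n$ points, $1\leq n\leq p$, and let $\theta_1,\dots,\theta_n$, $\mathfrak{V}$, $\mathfrak{W}$ be the angles and the families of vectors given by the CS decomposition related to $J$ (described in the context). Then: 1. $P\{|J\cap\phi|=n\}=\prod_{i=1}^{n}\cos^{2}\theta_{i}$ and, for $k=1,\dots,n-1$, $$P\{|J\cap\phi|=k\}=\sum_{1\leq i_{1}<\dots<i_{k}\leq n}\ \prod_{j=1}^{k}\cos^{2}\theta_{i_{j}}\times\prod_{j\notin\{i_{1},\dots,i_{k}\}}\sin^{2}\theta_{j}.$$ 2. $P\{|J\cap\phi^{c}|=n\}=\prod_{i=1}^{n}\sin^{2}\theta_{i}$ and, for $k=1,\dots,n-1$, $$P\{|J\cap\phi^{c}|=k\}=\sum_{1\leq i_{1}<\dots<i_{k}\leq n}\ \prod_{j=1}^{k}\sin^{2}\theta_{i_{j}}\times\prod_{j\notin\{i_{1},\dots,i_{k}\}}\cos^{2}\theta_{j}.$$ 3. If $n<p$ and $P\{J\subset\phi\}>0$, then the conditioned process $\{\phi\mid J\subset\phi\}\setminus J$ is determinantal, with $\{\phi\mid J\subset\phi\}\setminus J=\phi(\mathfrak{W})$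 (equality in law). 4. If $N-p>n$ and $P\{J\subset\phi^{c}\}>0$, then the conditioned process $\{\phi\mid J\subset\phi^{c}\}$ is determinantal, with $\{\phi\mid J\subset\phi^{c}\}=\phi(\mathfrak{V}\cup\mathfrak{W})$ (equality in law). 5. If $P\{J\subset\phi\}>0$, then for all $K\subset\{1,\dots,N\}\setminus J$ we have $P\{K\subset\phi(\mathfrak{W})\}\leq P\{K\subset\phi\}$; if $P\{J\subset\phi^{c}\}>0$, then for all $K\subset\{1,\dots,N\}\setminus J$ we have $P\{K\subset\phi\}\leq P\{K\subset\phi(\mathfrak{V}\cup\mathfrak{W})\}$.
   Context: Determinantal process: let $F$ be a finite set and $\mathfrak{Z}=\{z^1,\dots,z^m\}$ a set of $m$ orthonormal vectors $z^i=(z^i_x)_{x\in F}\in\mathbb{C}^F$. The process $\phi(\mathfrak{Z})$ is the random subset of $F$ of cardinality $m$ with $P\{\phi=\{i_1,\dots,i_m\}\}=\left|\det\left((z^k_{i_j})_{k,j=1,\dots,m}\right)\right|^2$ for every $m$-element subset of $F$; if $m=0$, $\phi(\emptyset)=\emptyset$. The law depends only on the span of $\mathfrak{Z}$. CS decomposition related to $J$: put $J^c=\{1,\dots,N\}\setminus J$, with $|J|=n\le p$. Reordering coordinates, identify $\mathbb{C}^N$ with $\mathbb{C}^J\oplus\mathbb{C}^{J^c}$ and write vectors as columns $\begin{bmatrix}a\\ b\end{bmatrix}$ with $a\in\mathbb{C}^J\cong\mathbb{C}^n$ and $b\in\mathbb{C}^{J^c}\cong\mathbb{C}^{N-n}$.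 The CS decomposition of a unitary matrix whose first $p$ columns form an orthonormal basis of $E$ and whose last $N-p$ columns form an orthonormal basis of $E^\perp$, partitioned after the $n$ rows indexed by $J$, yields: an orthonormal family $u^1,\dots,u^n$ in $\mathbb{C}^J$; angles $0\le\theta_1\le\dots\le\theta_n\le\pi/2$; and two families $\mathfrak{V}$ and $\mathfrak{W}=\{W^1,\dots,W^{p-n}\}$ in $\mathbb{C}^{J^c}$ (with $\mathfrak{W}$ empty if $n=p$), such that $\mathfrak{V}\cup\mathfrak{W}$ is an orthonormal family and the following holds. (i) If $p+n\le N$: $\mathfrak{V}=\{V^1,\dots,V^n\}$, and the vectors $\begin{bmatrix}u^i\cos\theta_i\\ V^i\sin\theta_i\end{bmatrix}$, $i=1,\dots,n$, together with $\begin{bmatrix}0\\ W^i\end{bmatrix}$, $i=1,\dots,p-n$, form an orthonormal basis of $E$. An orthonormal basis of $E^\perp$ is given by $\begin{bmatrix}u^i\sin\theta_i\\ -V^i\cos\theta_i\end{bmatrix}$, $i=1,\dots,n$, together with $\begin{bmatrix}0\\ \tilde W^i\end{bmatrix}$, $i=1,\dots,N-p-n$, where the $\tilde W^i$ complete $\mathfrak{V}\cup\mathfrak{W}$ to an orthonormal basis of $\mathbb{C}^{J^c}$. (ii) If $p+n>N$: $\mathfrak{V}=\{V^1,\dots,V^{N-p}\}$, $\theta_1=\dots=\theta_{n+p-N}=0$, and the vectors $\begin{bmatrix}u^i\\ 0\end{bmatrix}$, $i=1,\dots,n+p-N$, $\begin{bmatrix}u^i\cos\theta_i\\ V^{i-n-p+N}\sin\theta_i\end{bmatrix}$,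 $i=n+p-N+1,\dots,n$, and $\begin{bmatrix}0\\ W^i\end{bmatrix}$, $i=1,\dots,p-n$, form an orthonormal basis of $E$. An orthonormal basis of $E^\perp$ is given by $\begin{bmatrix}u^{n+p-N+i}\sin\theta_{n+p-N+i}\\ -V^i\cos\theta_{n+p-N+i}\end{bmatrix}$, $i=1,\dots,N-p$. The processes $\phi(\mathfrak{W})$ and $\phi(\mathfrak{V}\cup\mathfrak{W})$ are random subsets of $J^c$. $\{\phi\mid J\subset\phi\}$ and $\{\phi\mid J\subset\phi^c\}$ denote $\phi$ conditioned on the indicated events. *)

theory Defs
  imports
    "HOL-Probability.Probability_Mass_Function"
    "HOL-Library.Function_Algebras"
    "Jordan_Normal_Form.Determinant"
begin

section \<open>Coordinate spaces\<close>

text \<open>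
  For a finite set \<open>F\<close> of naturals, a vector of \<open>\<complex>\<^sup>F\<close> is a function \<^typ>\<open>nat \<Rightarrow> complex\<close> vanishing
  outside \<open>F\<close>.  With this encoding \<open>cspace J\<close> and \<open>cspace (F - J)\<close> are literally subspaces of \<open>cspace F\<close>,
  so no reordering of the coordinates is needed to speak about block columns.
\<close>

type_synonym cvec = "nat \<Rightarrow> complex"

definition cscale :: "complex \<Rightarrow> cvec \<Rightarrow> cvec" where
  "cscale c f = (\<lambda>x. c * f x)"

interpretation cvec: vector_space cscale
  by unfold_locales (auto simp: cscale_def fun_eq_iff algebra_simps)

definition cspace :: "nat set \<Rightarrow> cvec set" where
  "cspace F = {f. \<forall>x. x \<notin> F \<longrightarrow> f x = 0}"

definition cinner :: "nat set \<Rightarrow> cvec \<Rightarrow> cvec \<Rightarrow> complex" where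
  "cinner F f g = (\<Sum>x\<in>F. f x * cnj (g x))"

definition orthonormal :: "nat set \<Rightarrow> cvec list \<Rightarrow> bool" where
  "orthonormal F Z \<longleftrightarrow> set Z \<subseteq> cspace F \<and>
     (\<forall>i<length Z. \<forall>j<length Z. cinner F (Z ! i) (Z ! j) = (if i = j then 1 else 0))"

definition orthonormal_basis :: "nat set \<Rightarrow> cvec set \<Rightarrow> cvec list \<Rightarrow> bool" where
  "orthonormal_basis F E Z \<longleftrightarrow> orthonormal F Z \<and> cvec.span (set Z) = E"

definition orth_compl :: "nat set \<Rightarrow> cvec set \<Rightarrow> cvec set" where
  "orth_compl F E = {f \<in> cspace F. \<forall>g\<in>E. cinner F f g = 0}"

section \<open>Determinantal processes\<close>

definition minor_mat :: "cvec list \<Rightarrow> (nat \<Rightarrow> nat) \<Rightarrow> complex mat" where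
  "minor_mat Z i = Matrix.mat (length Z) (length Z) (\<lambda>(k, j). (Z ! k) (i j))"

text \<open>
  The points of \<open>S\<close> are listed in increasing order; the modulus of the determinant does not depend
  on this choice.
\<close>

definition det_weight :: "nat set \<Rightarrow> cvec list \<Rightarrow> nat set \<Rightarrow> real" where
  "det_weight F Z S =
     (if S \<subseteq> F \<and> card S = length Z
      then (cmod (Determinant.det (minor_mat Z ((!) (sorted_list_of_set S)))))\<^sup>2 else 0)"

text \<open>
  The law of the process.  It is the probability mass function with the above weights if \<open>F\<close> is
  finite and \<open>Z\<close> is orthonormal in \<open>\<complex>\<^sup>F\<close>, see \<open>pmf_det_process\<close> below.
\<close>

definition det_process :: "nat set \<Rightarrow> cvec list \<Rightarrow> nat set pmf" where
  "det_process F Z = embed_pmf (det_weight F Z)"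

lemma minor_mat_carrier [simp]: "minor_mat Z i \<in> carrier_mat (length Z) (length Z)"
  by (simp add: minor_mat_def)

lemma det_minor_mat:
  "Determinant.det (minor_mat Z g) =
    (\<Sum>p | p permutes {0..<length Z}. signof p * (\<Prod>j<length Z. (Z ! p j) (g j)))"
proof -
  have "(\<Prod>j<length Z. minor_mat Z g $$ (p j, j)) = (\<Prod>j<length Z. (Z ! p j) (g j))"
    if "p permutes {0..<length Z}" for p
  proof (rule prod.cong)
    fix j assume "j \<in> {..<length Z}"
    then have "p j < length Z" using permutes_in_image[OF that, of j] by auto
    then show "minor_mat Z g $$ (p j, j) = (Z ! p j) (g j)"
      using \<open>j \<in> _\<close> by (simp add: minor_mat_def)
  qed simp
  then show ?thesis
    by (subst det_col[OF minor_mat_carrier]) (auto intro!: sum.cong)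
qed

lemma sum_det_minor_PiE:
  assumes "finite F" "orthonormal F Z"
  shows "(\<Sum>g\<in>{..<length Z} \<rightarrow>\<^sub>E F. (cmod (Determinant.det (minor_mat Z g)))\<^sup>2) = fact (length Z)"
proof -
  define m where "m = length Z"
  define P where "P = {p. p permutes {0..<m}}"
  have finP: "finite P" by (simp add: P_def finite_permutations)
  have sgn: "cnj (signof p) = (signof p :: complex)" for p :: "nat \<Rightarrow> nat"
    by (simp add: sign_def)
  have "of_real (\<Sum>g\<in>{..<m} \<rightarrow>\<^sub>E F. (cmod (Determinant.det (minor_mat Z g)))\<^sup>2)
      = (\<Sum>g\<in>{..<m} \<rightarrow>\<^sub>E F. Determinant.det (minor_mat Z g) * cnj (Determinant.det (minor_mat Z g)))"
    by (simp add: complex_norm_square del: of_real_power)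
  also have "\<dots> = (\<Sum>g\<in>{..<m} \<rightarrow>\<^sub>E F. \<Sum>p\<in>P. \<Sum>q\<in>P. signof p * signof q *
        (\<Prod>j<m. (Z ! p j) (g j) * cnj ((Z ! q j) (g j))))"
    by (simp add: det_minor_mat sum_product sgn prod.distrib mult_ac flip: m_def P_def)
  also have "\<dots> = (\<Sum>p\<in>P. \<Sum>q\<in>P. \<Sum>g\<in>{..<m} \<rightarrow>\<^sub>E F. signof p * signof q *
        (\<Prod>j<m. (Z ! p j) (g j) * cnj ((Z ! q j) (g j))))"
    by (subst sum.swap, rule sum.cong, rule refl, rule sum.swap)
  also have "\<dots> = (\<Sum>p\<in>P. \<Sum>q\<in>P. signof p * signof q * (\<Prod>j<m. cinner F (Z ! p j) (Z ! q j)))"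
    using \<open>finite F\<close> by (simp add: cinner_def prod_sum_PiE flip: sum_distrib_left)
  also have "\<dots> = (\<Sum>p\<in>P. \<Sum>q\<in>P. if p = q then 1 else 0)"
  proof (intro sum.cong refl)
    fix p q assume pq: "p \<in> P" "q \<in> P"
    have lt: "p j < m" "q j < m" if "j < m" for j
      using pq that permutes_in_image[of p "{0..<m}" j] permutes_in_image[of q "{0..<m}" j]
      by (auto simp: P_def)
    have "(\<Prod>j<m. cinner F (Z ! p j) (Z ! q j)) = (\<Prod>j<m. if p j = q j then 1 else 0)"
      using assms(2) lt by (intro prod.cong) (auto simp: orthonormal_def m_def)
    also have "\<dots> = (if p = q then 1 else 0)"
    proof (cases "p = q")
      case False
      then obtain j where j: "p j \<noteq> q j" by auto
      then have "j < m" using pq permutes_not_in[of p "{0..<m}" j] permutes_not_in[of q "{0..<m}" j]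
        by (force simp: P_def)
      then show ?thesis using j False by (intro trans[OF prod_zero]) auto
    qed simp
    finally show "signof p * signof q * (\<Prod>j<m. cinner F (Z ! p j) (Z ! q j))
        = (if p = q then 1 else (0 :: complex))"
      by (simp add: sign_def)
  qed
  also have "\<dots> = of_nat (card P)" using finP by simp
  also have "card P = fact m" by (simp add: P_def card_permutations)
  finally have "complex_of_real (\<Sum>g\<in>{..<m} \<rightarrow>\<^sub>E F. (cmod (Determinant.det (minor_mat Z g)))\<^sup>2)
      = of_real (fact m)" by simp
  then show ?thesis unfolding of_real_eq_iff m_def .
qed

lemma det_minor_mat_permute:
  assumes "p permutes {..<length Z}" and "\<And>j. j < length Z \<Longrightarrow> g j = s (p j)"
  shows "cmod (Determinant.det (minor_mat Z g)) = cmod (Determinant.det (minor_mat Z s))"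
proof -
  let ?m = "length Z" and ?A = "transpose_mat (minor_mat Z s)"
  have p: "p permutes {0..<?m}" using assms(1) by (simp add: atLeast0LessThan)
  have lt: "p j < ?m" if "j < ?m" for j using permutes_in_image[OF p, of j] that by simp
  have "Determinant.det (minor_mat Z g) = Determinant.det (transpose_mat (minor_mat Z g))"
    by (simp add: Determinant.det_transpose[OF minor_mat_carrier])
  also have "transpose_mat (minor_mat Z g) = Matrix.mat ?m ?m (\<lambda>(i, j). ?A $$ (p i, j))"
    by (rule eq_matI) (auto simp: minor_mat_def assms(2) lt)
  also have "Determinant.det \<dots> = signof p * Determinant.det ?A"
    by (rule det_permute_rows[OF _ p]) simp
  also have "Determinant.det ?A = Determinant.det (minor_mat Z s)"
    by (rule Determinant.det_transpose[OF minor_mat_carrier])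
  finally show ?thesis by (simp add: norm_mult sign_def)
qed

lemma sum_det_weight:
  assumes "finite F" "orthonormal F Z"
  shows "(\<Sum>S\<in>Pow F. det_weight F Z S) = 1"
proof -
  define m where "m = length Z"
  define w where "w g = (cmod (Determinant.det (minor_mat Z g)))\<^sup>2" for g
  define G where "G S = {g \<in> {..<m} \<rightarrow>\<^sub>E F. inj_on g {..<m} \<and> g ` {..<m} = S}" for S
  have finE: "finite ({..<m} \<rightarrow>\<^sub>E F)" using assms(1) by (simp add: finite_PiE)
  have non_inj: "w g = 0" if ni: "\<not> inj_on g {..<m}" for g
  proof -
    have "\<exists>i j. i < m \<and> j < m \<and> i \<noteq> j \<and> g i = g j"
      using ni by (auto simp: inj_on_def)
    then obtain i j where ij: "i < m" "j < m" "i \<noteq> j" "g i = g j" by (elim exE conjE)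
    let ?A = "transpose_mat (minor_mat Z g)"
    have "Determinant.det ?A = 0"
      by (rule Determinant.det_identical_rows[of _ m i j])
         (use ij in \<open>auto simp: minor_mat_def m_def intro!: eq_vecI\<close>)
    then show ?thesis by (simp add: w_def Determinant.det_transpose[OF minor_mat_carrier])
  qed
  have fibre: "sum w (G S) = fact m * det_weight F Z S" if "S \<subseteq> F" for S
  proof (cases "card S = m")
    case False
    have "card S = m" if "g \<in> G S" for g
      using that card_image[of g "{..<m}"] by (simp add: G_def)
    with False have "G S = {}" by blast
    then show ?thesis using False by (simp add: det_weight_def m_def)
  next
    case True
    define s where "s = (!) (sorted_list_of_set S)"
    have finS: "finite S" using that assms(1) finite_subset by blast
    have s: "bij_betw s {..<m} S"
      unfolding s_def by (rule bij_betw_nth) (use finS True in simp_all)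
    have bij: "bij_betw (\<lambda>p. restrict (s \<circ> p) {..<m}) {p. p permutes {..<m}} (G S)"
    proof (rule bij_betwI')
      fix p q assume pq: "p \<in> {p. p permutes {..<m}}" "q \<in> {p. p permutes {..<m}}"
      show "(restrict (s \<circ> p) {..<m} = restrict (s \<circ> q) {..<m}) = (p = q)"
      proof
        assume eq: "restrict (s \<circ> p) {..<m} = restrict (s \<circ> q) {..<m}"
        show "p = q"
        proof
          fix x
          show "p x = q x"
          proof (cases "x < m")
            case True
            then have "s (p x) = s (q x)" using fun_cong[OF eq, of x] by simp
            moreover have "p x \<in> {..<m}" "q x \<in> {..<m}"
              using pq True permutes_in_image[of p "{..<m}" x] permutes_in_image[of q "{..<m}" x]
              by simp_all
            ultimately show ?thesis using inj_onD[OF bij_betw_imp_inj_on[OF s]] by blast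
          next
            case False
            then have "x \<notin> {..<m}" by simp
            then show ?thesis using pq by (simp add: permutes_not_in)
          qed
        qed
      qed simp
    next
      fix p assume "p \<in> {p. p permutes {..<m}}"
      then have "bij_betw (s \<circ> p) {..<m} S"
        using bij_betw_trans[OF permutes_imp_bij s] by auto
      then have "bij_betw (restrict (s \<circ> p) {..<m}) {..<m} S"
        by (rule iffD1[OF bij_betw_cong, rotated]) simp
      then show "restrict (s \<circ> p) {..<m} \<in> G S"
        using that unfolding G_def bij_betw_def by (auto intro!: PiE_I)
    next
      fix g assume g: "g \<in> G S"
      define p where "p = (\<lambda>x. if x < m then inv_into {..<m} s (g x) else x)"
      have "bij_betw g {..<m} S" using g by (auto simp: G_def bij_betw_def)
      then have "bij_betw (inv_into {..<m} s \<circ> g) {..<m} {..<m}"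
        by (rule bij_betw_trans[OF _ bij_betw_inv_into[OF s]])
      then have "bij_betw p {..<m} {..<m}"
        by (rule iffD1[OF bij_betw_cong, rotated]) (simp add: p_def)
      then have "p permutes {..<m}"
        by (rule bij_imp_permutes) (simp add: p_def)
      moreover have "g = restrict (s \<circ> p) {..<m}"
      proof
        fix x
        show "g x = restrict (s \<circ> p) {..<m} x"
        proof (cases "x < m")
          case True
          then have "g x \<in> S" using g by (auto simp: G_def)
          then have "g x \<in> s ` {..<m}" using bij_betw_imp_surj_on[OF s] by simp
          then show ?thesis using True by (simp add: p_def f_inv_into_f)
        next
          case False
          then show ?thesis using g by (simp add: G_def PiE_def extensional_def)
        qed
      qed
      ultimately show "\<exists>p\<in>{p. p permutes {..<m}}. g = restrict (s \<circ> p) {..<m}"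
        by (intro bexI[of _ p]) simp_all
    qed
    have "sum w (G S) = (\<Sum>p | p permutes {..<m}. w (restrict (s \<circ> p) {..<m}))"
      using sum.reindex_bij_betw[OF bij, of w] by simp
    also have "\<dots> = (\<Sum>p | p permutes {..<m}. w s)"
      unfolding w_def by (intro sum.cong refl arg_cong[of _ _ "\<lambda>x. x\<^sup>2"] det_minor_mat_permute)
        (auto simp: m_def)
    also have "\<dots> = fact m * det_weight F Z S"
      using True that by (simp add: card_permutations det_weight_def w_def s_def m_def)
    finally show ?thesis .
  qed
  have "fact m = (\<Sum>g\<in>{..<m} \<rightarrow>\<^sub>E F. w g)"
    using sum_det_minor_PiE[OF assms] by (simp add: w_def m_def)
  also have "\<dots> = (\<Sum>g\<in>{g \<in> {..<m} \<rightarrow>\<^sub>E F. inj_on g {..<m}}. w g)"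
    by (rule sum.mono_neutral_right) (use finE non_inj in auto)
  also have "\<dots> = (\<Sum>S\<in>Pow F. \<Sum>g | g \<in> {g \<in> {..<m} \<rightarrow>\<^sub>E F. inj_on g {..<m}} \<and> g ` {..<m} = S. w g)"
    by (rule sum.group[symmetric]) (use finE assms(1) in auto)
  also have "\<dots> = (\<Sum>S\<in>Pow F. sum w (G S))"
    by (simp add: G_def)
  also have "\<dots> = (\<Sum>S\<in>Pow F. fact m * det_weight F Z S)"
    by (intro sum.cong refl fibre) auto
  also have "\<dots> = fact m * (\<Sum>S\<in>Pow F. det_weight F Z S)"
    by (simp add: sum_distrib_left)
  finally show ?thesis by simp
qed

lemma pmf_det_process:
  assumes "finite F" "orthonormal F Z"
  shows "pmf (det_process F Z) S = det_weight F Z S"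
proof -
  have nn: "0 \<le> det_weight F Z S" for S by (simp add: det_weight_def)
  have "(\<integral>\<^sup>+ S. ennreal (det_weight F Z S) \<partial>count_space UNIV)
      = (\<Sum>S\<in>Pow F. ennreal (det_weight F Z S))"
    by (rule nn_integral_count_space'[of "Pow F"]) (use assms(1) in \<open>auto simp: det_weight_def\<close>)
  also have "\<dots> = 1"
    by (simp add: sum_ennreal nn sum_det_weight[OF assms])
  finally show ?thesis
    unfolding det_process_def by (rule pmf_embed_pmf[OF nn])
qed

section \<open>CS decomposition\<close>

text \<open>The block column with upper part \<open>a\<close> (rows in \<open>J\<close>) and lower part \<open>b\<close> (remaining rows).\<close>

definition block :: "nat set \<Rightarrow> cvec \<Rightarrow> cvec \<Rightarrow> cvec" where
  "block J a b = (\<lambda>x. if x \<in> J then a x else b x)"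

text \<open>
  \<open>cs_decomposition N E J u \<theta> V W\<close> says that \<open>u\<close>, \<open>\<theta>\<close>, \<open>V\<close>, \<open>W\<close> are the data of a CS
  decomposition related to \<open>J\<close> of the subspace \<open>E\<close> of \<open>cspace {1..N}\<close>.  Families are lists, so indices start at
  \<open>0\<close>.  The two branches are the cases \<open>p + n \<le> N\<close> and \<open>p + n > N\<close>; in the second one,
  \<open>d = n + p - N > 0\<close> is the number of angles that are forced to vanish.
\<close>

definition cs_decomposition ::
  "nat \<Rightarrow> cvec set \<Rightarrow> nat set \<Rightarrow> cvec list \<Rightarrow> real list \<Rightarrow> cvec list \<Rightarrow> cvec list \<Rightarrow> bool" where
  "cs_decomposition N E J u \<theta> V W \<longleftrightarrow>
    (let p = cvec.dim E; n = card J; F = {1..N}; Jc = F - J;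
         c = (\<lambda>i. complex_of_real (cos (\<theta> ! i)));
         s = (\<lambda>i. complex_of_real (sin (\<theta> ! i)))
     in length u = n \<and> orthonormal J u \<and>
        length \<theta> = n \<and> sorted \<theta> \<and> set \<theta> \<subseteq> {0..pi/2} \<and>
        length W = p - n \<and> orthonormal Jc (V @ W) \<and>
        (if p + n \<le> N then
           length V = n \<and>
           orthonormal_basis F E
             (map (\<lambda>i. block J (cscale (c i) (u ! i)) (cscale (s i) (V ! i))) [0..<n]
              @ map (block J 0) W) \<and>
           (\<exists>W'. length W' = N - p - n \<and>
              orthonormal_basis Jc (cspace Jc) (V @ W @ W') \<and>
              orthonormal_basis F (orth_compl F E)
                (map (\<lambda>i. block J (cscale (s i) (u ! i)) (- cscale (c i) (V ! i))) [0..<n]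
                 @ map (block J 0) W'))
         else
           (let d = n + p - N
            in length V = N - p \<and>
               (\<forall>i<d. \<theta> ! i = 0) \<and>
               orthonormal_basis F E
                 (map (\<lambda>i. block J (u ! i) 0) [0..<d]
                  @ map (\<lambda>i. block J (cscale (c i) (u ! i)) (cscale (s i) (V ! (i - d)))) [d..<n]
                  @ map (block J 0) W) \<and>
               orthonormal_basis F (orth_compl F E)
                 (map (\<lambda>i. block J (cscale (s (d + i)) (u ! (d + i)))
                                   (- cscale (c (d + i)) (V ! i))) [0..<N - p]))))"

end

theory Submission
  imports Defs
begin

text \<open>
  The law is studied through its minors and one formula for its generating function.  For an orthonormal family \<open>Z\<close> the determinantal process
  satisfies \<open>E (\<Prod>x\<in>\<phi>. h x) = det (\<Sum>x\<in>F. h x * (Z ! i) x * cnj ((Z ! j) x))\<close>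
  (\<open>generating_function\<close>, a form of the Cauchy--Binet identity).  The law does not depend on the
  basis (\<open>det_process_basis_independent\<close>), so it may be computed in the basis \<open>X @ W\<close> of \<open>E\<close> given by
  the CS decomposition, where \<open>X\<close> consists of the \<open>n\<close> vectors whose part in \<open>J\<close> is a multiple of some
  \<open>u\<^sub>i\<close>, and \<open>W\<close> vanishes on \<open>J\<close>.

  The CS basis stays orthogonal after restriction to \<open>J\<close>: the Gram matrix on \<open>J\<close> is diagonal with
  entries \<open>cos\<^sup>2 \<theta>\<^sub>i\<close> and zeros.  With \<open>h = t\<close> on \<open>J\<close> and \<open>h = 1\<close> elsewhere the generating
  function becomes \<open>\<Prod>i. t cos\<^sup>2 \<theta>\<^sub>i + sin\<^sup>2 \<theta>\<^sub>i\<close>, and comparing coefficients gives the law of the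
  number of points in \<open>J\<close>, hence also of the number of points missing from \<open>J\<close> (\<open>count_prob\<close>).

  The conditional laws come from the minors themselves.  If \<open>J \<subseteq> S\<close>, the minor at \<open>S\<close> is block
  triangular with a diagonal block that depends on \<open>J\<close> only and with the minor of \<open>W\<close> at \<open>S - J\<close> as
  the other one (\<open>conditioned_on_inclusion\<close>).  If \<open>S\<close> avoids \<open>J\<close>, only the restrictions of the vectors to
  the complement of \<open>J\<close> enter, and these are \<open>V @ W\<close> with \<open>V\<close> scaled by the \<open>sin \<theta>\<^sub>i\<close>
  (\<open>conditioned_on_exclusion\<close>).

  For the comparison of inclusion probabilities, the choice \<open>h = 1 + s\<close> on \<open>K\<close> and \<open>h = 1\<close> elsewhere
  shows that \<open>P (K \<subseteq> \<phi>)\<close> is the sum of the principal minors of size \<open>card K\<close> of the Gram matrix of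
  the family on \<open>K\<close> (\<open>inclusion_prob\<close>).  These minors are nonnegative.  Dropping the vectors of \<open>X\<close>
  removes terms, and replacing \<open>sin \<theta>\<^sub>i\<close> by \<open>1\<close> can only enlarge terms; these are the two inequalities.
\<close>

section \<open>Determinants over finite index sets\<close>

text \<open>
  A determinant indexed by an arbitrary finite set: minors and principal minors are then the same
  expression over different index sets, and subfamilies of vectors need no renumbering.
\<close>

definition leibniz :: "nat set \<Rightarrow> (nat \<Rightarrow> nat \<Rightarrow> 'a::comm_ring_1) \<Rightarrow> 'a" where
  "leibniz T A = (\<Sum>p | p permutes T. signof p * (\<Prod>i\<in>T. A i (p i)))"

lemma det_minor_mat_eq_leibniz:
  "Determinant.det (minor_mat Z g) = leibniz {..<length Z} (\<lambda>j k. (Z ! k) (g j))"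
  by (simp add: det_minor_mat leibniz_def atLeast0LessThan)

lemma prod_permutes:
  assumes "p permutes T"
  shows "(\<Prod>i\<in>T. f (p i)) = (\<Prod>i\<in>T. f i)"
  using prod.permute[OF assms, of f] by (simp add: o_def)

lemma leibniz_cong:
  assumes "\<And>i j. i \<in> T \<Longrightarrow> j \<in> T \<Longrightarrow> A i j = B i j"
  shows "leibniz T A = leibniz T B"
  unfolding leibniz_def
  by (intro sum.cong refl arg_cong2[of _ _ _ _ "(*)"] prod.cong assms)
     (auto simp: permutes_in_image)

lemma leibniz_scale:
  "leibniz T (\<lambda>i j. a i * b j * A i j) = (\<Prod>i\<in>T. a i * b i) * leibniz T A"
proof -
  have "(\<Prod>i\<in>T. a i * b (p i) * A i (p i)) = (\<Prod>i\<in>T. a i * b i) * (\<Prod>i\<in>T. A i (p i))"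
    if "p permutes T" for p
    by (simp add: prod.distrib prod_permutes[OF that])
  then show ?thesis
    by (simp add: leibniz_def sum_distrib_left mult.left_commute)
qed

lemma leibniz_diagonal:
  assumes "finite T" and "\<And>i j. i \<in> T \<Longrightarrow> j \<in> T \<Longrightarrow> i \<noteq> j \<Longrightarrow> A i j = 0"
  shows "leibniz T A = (\<Prod>i\<in>T. A i i)"
proof -
  have "signof p * (\<Prod>i\<in>T. A i (p i)) = (if p = id then \<Prod>i\<in>T. A i i else 0)"
    if p: "p permutes T" for p
  proof (cases "p = id")
    case False
    then obtain i where i: "p i \<noteq> i" by (auto simp: fun_eq_iff)
    then have "i \<in> T" "p i \<in> T"
      using p permutes_not_in[OF p] permutes_in_image[OF p] by auto
    with i assms have "(\<Prod>i\<in>T. A i (p i)) = 0" by (metis prod_zero)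
    then show ?thesis using False by simp
  qed simp
  then have "leibniz T A = (\<Sum>p | p permutes T. if p = id then \<Prod>i\<in>T. A i i else 0)"
    by (simp add: leibniz_def)
  also have "\<dots> = (\<Prod>i\<in>T. A i i)"
    using assms(1) by (simp add: finite_permutations permutes_id)
  finally show ?thesis .
qed

text \<open>
  Expanding each factor of the Leibniz formula, the set \<open>U\<close> collects the indices at which the term
  with \<open>A\<close> is chosen; the Kronecker symbols elsewhere leave only the permutations supported in
  \<open>U\<close>, so the coefficient of \<open>s\<^sup>k\<close> is the sum of the principal minors of size \<open>k\<close>.
\<close>

lemma leibniz_one_plus:
  assumes "finite T"
  shows "leibniz T (\<lambda>i j. (if i = j then 1 else 0) + s * A i j)
    = (\<Sum>U\<in>Pow T. s ^ card U * leibniz U A)"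
proof -
  let ?P = "\<lambda>T. {p. p permutes T}"
  have fin: "finite (?P T)" using assms by (simp add: finite_permutations)
  have "leibniz T (\<lambda>i j. (if i = j then 1 else 0) + s * A i j)
      = (\<Sum>p\<in>?P T. \<Sum>U\<in>Pow T. signof p * ((\<Prod>i\<in>U. s * A i (p i)) *
            (\<Prod>i\<in>T - U. if i = p i then 1 else 0)))"
    unfolding leibniz_def
    by (subst add.commute) (simp add: prod_add[OF assms] sum_distrib_left)
  also have "\<dots> = (\<Sum>U\<in>Pow T. \<Sum>p\<in>?P T. signof p * ((\<Prod>i\<in>U. s * A i (p i)) *
            (\<Prod>i\<in>T - U. if i = p i then 1 else 0)))"
    by (rule sum.swap)
  also have "\<dots> = (\<Sum>U\<in>Pow T. s ^ card U * leibniz U A)"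
  proof (rule sum.cong[OF refl])
    fix U assume "U \<in> Pow T"
    then have U: "U \<subseteq> T" by simp
    have sub: "?P U \<subseteq> ?P T" using U by (auto intro: permutes_subset)
    have zero: "(\<Prod>i\<in>T - U. if i = p i then 1 else (0::'a)) = 0" if "p \<in> ?P T - ?P U" for p
    proof -
      have "\<not> (\<forall>x\<in>T - U. p x = x)"
        using that permutes_superset[of p T U] by auto
      then obtain x where "x \<in> T - U" "p x \<noteq> x" by blast
      then show ?thesis using assms by (intro prod_zero bexI[of _ x]) auto
    qed
    have one: "(\<Prod>i\<in>T - U. if i = p i then 1 else (0::'a)) = 1" if "p \<in> ?P U" for p
      using that by (intro prod.neutral) (auto simp: permutes_not_in)
    have "(\<Sum>p\<in>?P T. signof p * ((\<Prod>i\<in>U. s * A i (p i)) *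
            (\<Prod>i\<in>T - U. if i = p i then 1 else 0)))
        = (\<Sum>p\<in>?P U. signof p * (\<Prod>i\<in>U. s * A i (p i)))"
      by (rule sum.mono_neutral_cong_right[OF fin sub]) (use zero one in simp_all)
    also have "\<dots> = s ^ card U * leibniz U A"
      by (simp add: leibniz_def prod.distrib sum_distrib_left mult.left_commute)
    finally show "(\<Sum>p\<in>?P T. signof p * ((\<Prod>i\<in>U. s * A i (p i)) *
            (\<Prod>i\<in>T - U. if i = p i then 1 else 0))) = s ^ card U * leibniz U A" .
  qed
  finally show ?thesis .
qed

text \<open>
  Andreief's identity, the Cauchy--Binet formula summed over tuples instead of subsets.  Both
  determinants are expanded over permutations \<open>p\<close> and \<open>q\<close>; the sum over tuples then factorises into
  Gram entries, and only the quotient of the two permutations matters, whence the factor \<open>fact (card T)\<close>.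
\<close>

lemma andreief:
  fixes y :: "nat \<Rightarrow> 'b \<Rightarrow> complex"
  assumes "finite T" "finite F"
  shows "(\<Sum>g\<in>T \<rightarrow>\<^sub>E F. (\<Prod>i\<in>T. h (g i)) * of_real ((cmod (leibniz T (\<lambda>i j. y j (g i))))\<^sup>2))
    = fact (card T) * leibniz T (\<lambda>i j. \<Sum>x\<in>F. h x * y i x * cnj (y j x))"
    (is "_ = _ * leibniz T ?M")
proof -
  define P where "P = {p. p permutes T}"
  have sgn: "cnj (signof p) = (signof p :: complex)" for p :: "nat \<Rightarrow> nat"
    by (simp add: sign_def)
  have "(\<Sum>g\<in>T \<rightarrow>\<^sub>E F. (\<Prod>i\<in>T. h (g i)) * of_real ((cmod (leibniz T (\<lambda>i j. y j (g i))))\<^sup>2))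
      = (\<Sum>g\<in>T \<rightarrow>\<^sub>E F. \<Sum>p\<in>P. \<Sum>q\<in>P. signof p * signof q *
        (\<Prod>i\<in>T. h (g i) * y (p i) (g i) * cnj (y (q i) (g i))))"
  proof (rule sum.cong[OF refl])
    fix g
    let ?L = "leibniz T (\<lambda>i j. y j (g i))"
    have "(\<Prod>i\<in>T. h (g i)) * of_real ((cmod ?L)\<^sup>2) = (\<Prod>i\<in>T. h (g i)) * (?L * cnj ?L)"
      by (simp only: complex_norm_square)
    also have "?L * cnj ?L = (\<Sum>p\<in>P. \<Sum>q\<in>P. (signof p * (\<Prod>i\<in>T. y (p i) (g i))) *
        (signof q * (\<Prod>i\<in>T. cnj (y (q i) (g i)))))"
      by (simp only: leibniz_def P_def[symmetric] cnj_sum complex_cnj_mult cnj_prod sgn sum_product)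
    finally show "(\<Prod>i\<in>T. h (g i)) * of_real ((cmod ?L)\<^sup>2) = (\<Sum>p\<in>P. \<Sum>q\<in>P. signof p * signof q *
        (\<Prod>i\<in>T. h (g i) * y (p i) (g i) * cnj (y (q i) (g i))))"
      by (simp add: sum_distrib_left prod.distrib mult_ac)
  qed
  also have "\<dots> = (\<Sum>p\<in>P. \<Sum>q\<in>P. \<Sum>g\<in>T \<rightarrow>\<^sub>E F. signof p * signof q *
        (\<Prod>i\<in>T. h (g i) * y (p i) (g i) * cnj (y (q i) (g i))))"
    by (subst sum.swap, rule sum.cong, rule refl, rule sum.swap)
  also have "\<dots> = (\<Sum>p\<in>P. \<Sum>q\<in>P. signof p * signof q * (\<Prod>i\<in>T. ?M (p i) (q i)))"
    using assms by (simp add: prod_sum_PiE flip: sum_distrib_left)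
  also have "\<dots> = (\<Sum>p\<in>P. leibniz T ?M)"
  proof (rule sum.cong[OF refl])
    fix p assume "p \<in> P"
    then have p: "p permutes T" by (simp add: P_def)
    have "(\<Sum>q\<in>P. signof p * signof q * (\<Prod>i\<in>T. ?M (p i) (q i)))
        = (\<Sum>q\<in>P. signof p * signof (q \<circ> p) * (\<Prod>i\<in>T. ?M (p i) ((q \<circ> p) i)))"
      unfolding P_def by (rule sum_permutations_compose_right[OF p])
    also have "\<dots> = (\<Sum>q\<in>P. signof q * (\<Prod>i\<in>T. ?M i (q i)))"
    proof (rule sum.cong[OF refl])
      fix q assume "q \<in> P"
      then have q: "q permutes T" by (simp add: P_def)
      have "permutation q" "permutation p"
        using p q assms(1) permutation_permutes by blast+
      then have "sign (q \<circ> p) = sign q * sign p" by (rule sign_compose)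
      moreover have "(of_int (sign p) :: complex) * of_int (sign p) = 1"
        by (simp add: sign_def)
      moreover have "(\<Prod>i\<in>T. ?M (p i) ((q \<circ> p) i)) = (\<Prod>i\<in>T. ?M i (q i))"
        using prod_permutes[OF p, of "\<lambda>i. ?M i (q i)"] by simp
      ultimately show "signof p * signof (q \<circ> p) * (\<Prod>i\<in>T. ?M (p i) ((q \<circ> p) i))
          = signof q * (\<Prod>i\<in>T. ?M i (q i))"
        by (simp add: mult_ac)
    qed
    finally show "(\<Sum>q\<in>P. signof p * signof q * (\<Prod>i\<in>T. ?M (p i) (q i))) = leibniz T ?M"
      by (simp add: leibniz_def P_def)
  qed
  also have "\<dots> = fact (card T) * leibniz T ?M"
    using assms(1) by (simp add: P_def card_permutations)
  finally show ?thesis .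
qed

text \<open>
  By Andreief's identity, \<open>fact (card T)\<close> times this minor is a sum of squared moduli.
\<close>

lemma leibniz_gram_nonneg:
  fixes y :: "nat \<Rightarrow> 'b \<Rightarrow> complex"
  assumes "finite T" "finite F"
  shows "0 \<le> Re (leibniz T (\<lambda>i j. \<Sum>x\<in>F. y i x * cnj (y j x)))"
proof -
  let ?L = "leibniz T (\<lambda>i j. \<Sum>x\<in>F. y i x * cnj (y j x))"
  have "of_real (fact (card T)) * ?L =
      of_real (\<Sum>g\<in>T \<rightarrow>\<^sub>E F. (cmod (leibniz T (\<lambda>i j. y j (g i))))\<^sup>2)"
    using andreief[OF assms, of "\<lambda>_. 1" y] by simp
  from arg_cong[OF this, of Re] have "fact (card T) * Re ?L
      = (\<Sum>g\<in>T \<rightarrow>\<^sub>E F. (cmod (leibniz T (\<lambda>i j. y j (g i))))\<^sup>2)"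
    by (simp only: Re_complex_of_real times_complex.sel Im_complex_of_real mult_zero_left diff_zero)
  also have "\<dots> \<ge> 0" by (intro sum_nonneg) simp
  finally show ?thesis
    using mult_pos_neg[of "fact (card T)" "Re ?L"] fact_gt_zero[of "card T", where ?'a = real] by linarith
qed

section \<open>Generating functions of determinantal processes\<close>

text \<open>
  Reordering the points changes the determinant by a sign only.  Block arguments use this to list a
  chosen subset of the points first.
\<close>

lemma det_weight_enumeration:
  assumes g: "bij_betw g {..<length Z} S" and "S \<subseteq> F"
  shows "det_weight F Z S = (cmod (Determinant.det (minor_mat Z g)))\<^sup>2"
proof -
  let ?m = "length Z" and ?s = "(!) (sorted_list_of_set S)"
  have fin: "finite S" and card: "card S = ?m"
    using bij_betw_finite[OF g] bij_betw_same_card[OF g] by simp_all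
  have s: "bij_betw ?s {..<?m} S"
    by (rule bij_betw_nth) (use fin card in simp_all)
  define p where "p = (\<lambda>x. if x < ?m then inv_into {..<?m} ?s (g x) else x)"
  have "bij_betw (inv_into {..<?m} ?s \<circ> g) {..<?m} {..<?m}"
    by (rule bij_betw_trans[OF g bij_betw_inv_into[OF s]])
  then have "bij_betw p {..<?m} {..<?m}"
    by (rule iffD1[OF bij_betw_cong, rotated]) (simp add: p_def)
  then have p: "p permutes {..<?m}"
    by (rule bij_imp_permutes) (simp add: p_def)
  have "g j = ?s (p j)" if "j < ?m" for j
    using that g s by (simp add: p_def bij_betw_inv_into_right bij_betw_apply)
  then have "cmod (Determinant.det (minor_mat Z g)) = cmod (Determinant.det (minor_mat Z ?s))"
    by (rule det_minor_mat_permute[OF p])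
  then show ?thesis
    using assms(2) card by (simp add: det_weight_def)
qed

lemma det_minor_mat_not_inj:
  assumes "\<not> inj_on g {..<length Z}"
  shows "Determinant.det (minor_mat Z g) = 0"
proof -
  obtain i j where ij: "i < length Z" "j < length Z" "i \<noteq> j" "g i = g j"
    using assms by (auto simp: inj_on_def)
  have "Determinant.det (transpose_mat (minor_mat Z g)) = 0"
    by (rule Determinant.det_identical_rows[of _ "length Z" i j])
       (use ij in \<open>auto simp: minor_mat_def intro!: eq_vecI\<close>)
  then show ?thesis by (simp add: Determinant.det_transpose[OF minor_mat_carrier])
qed

text \<open>
  The multivariate generating function \<open>E (\<Prod>x\<in>\<phi>. h x)\<close> is the determinant of the Gram matrix with
  weight \<open>h\<close>.  This is Andreief's identity after grouping tuples by their image: tuples with a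
  repeated point contribute zero, and every subset with as many points as there are vectors arises
  from \<open>fact (length Z)\<close> tuples of equal weight.
\<close>

lemma generating_function:
  assumes "finite F"
  shows "(\<Sum>S\<in>Pow F. of_real (det_weight F Z S) * (\<Prod>x\<in>S. h x))
    = leibniz {..<length Z} (\<lambda>i j. \<Sum>x\<in>F. h x * (Z ! i) x * cnj ((Z ! j) x))"
proof -
  define m where "m = length Z"
  define w :: "(nat \<Rightarrow> nat) \<Rightarrow> complex" where "w g = (\<Prod>i<m. h (g i)) *
      of_real ((cmod (Determinant.det (minor_mat Z g)))\<^sup>2)" for g
  define I where "I = {g \<in> {..<m} \<rightarrow>\<^sub>E F. inj_on g {..<m}}"
  have finE: "finite ({..<m} \<rightarrow>\<^sub>E F)" using assms by (simp add: finite_PiE)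
  have fibre: "sum w {g \<in> I. g ` {..<m} = S}
      = fact m * (of_real (det_weight F Z S) * (\<Prod>x\<in>S. h x))" if S: "S \<subseteq> F" for S
  proof (cases "card S = m")
    case False
    have "card S = m" if "g \<in> I" "g ` {..<m} = S" for g
      using that card_image[of g "{..<m}"] by (simp add: I_def)
    with False have "{g \<in> I. g ` {..<m} = S} = {}" by blast
    then show ?thesis using False by (simp only: sum.empty) (simp add: det_weight_def m_def)
  next
    case True
    have finS: "finite S" using S assms finite_subset by blast
    have fib: "{g \<in> I. g ` {..<m} = S} = {g \<in> {..<m} \<rightarrow>\<^sub>E S. inj_on g {..<m}}"
    proof -
      have "g ` {..<m} = S" if "g \<in> {..<m} \<rightarrow>\<^sub>E S" "inj_on g {..<m}" for g
        using that finS True by (intro card_subset_eq) (auto simp: card_image)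
      then show ?thesis using S by (auto simp: I_def PiE_iff)
    qed
    have "w g = of_real (det_weight F Z S) * (\<Prod>x\<in>S. h x)"
      if "g \<in> {g \<in> I. g ` {..<m} = S}" for g
    proof -
      have g: "bij_betw g {..<length Z} S" using that by (auto simp: I_def bij_betw_def m_def)
      show ?thesis
        unfolding w_def det_weight_enumeration[OF g S]
        using prod.reindex_bij_betw[OF g, of h] by (simp add: m_def mult.commute)
    qed
    then have "sum w {g \<in> I. g ` {..<m} = S} =
        of_nat (card {g \<in> I. g ` {..<m} = S}) * (of_real (det_weight F Z S) * (\<Prod>x\<in>S. h x))"
      by simp
    also have "card {g \<in> I. g ` {..<m} = S} = fact m"
      unfolding fib using finS True
      by (subst card_inj_on_subset_funcset) (simp_all add: fact_prod_rev)
    finally show ?thesis by simp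
  qed
  have "fact m * leibniz {..<m} (\<lambda>i j. \<Sum>x\<in>F. h x * (Z ! i) x * cnj ((Z ! j) x))
      = (\<Sum>g\<in>{..<m} \<rightarrow>\<^sub>E F. w g)"
    using andreief[OF _ assms, of "{..<m}" h "(!) Z"]
    by (simp add: w_def det_minor_mat_eq_leibniz m_def)
  also have "\<dots> = (\<Sum>g\<in>I. w g)"
    by (rule sum.mono_neutral_right)
       (use finE in \<open>auto simp: I_def w_def m_def det_minor_mat_not_inj\<close>)
  also have "\<dots> = (\<Sum>S\<in>Pow F. sum w {g \<in> I. g ` {..<m} = S})"
    by (rule sum.group[symmetric]) (use finE assms in \<open>auto simp: I_def\<close>)
  also have "\<dots> = fact m * (\<Sum>S\<in>Pow F. of_real (det_weight F Z S) * (\<Prod>x\<in>S. h x))"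
    by (simp add: fibre sum_distrib_left)
  finally show ?thesis by (simp add: m_def)
qed

lemma measure_det_process:
  assumes "finite F" "orthonormal F Z"
  shows "measure_pmf.prob (det_process F Z) A = (\<Sum>S\<in>Pow F \<inter> A. det_weight F Z S)"
proof -
  have "set_pmf (det_process F Z) \<subseteq> Pow F"
    by (auto simp: set_pmf_eq pmf_det_process[OF assms] det_weight_def split: if_splits)
  then have "measure_pmf.prob (det_process F Z) A = measure_pmf.prob (det_process F Z) (Pow F \<inter> A)"
    by (intro measure_pmf.finite_measure_eq_AE) (auto simp: AE_measure_pmf_iff)
  also have "\<dots> = (\<Sum>S\<in>Pow F \<inter> A. det_weight F Z S)"
    using assms by (simp add: measure_measure_pmf_finite pmf_det_process)
  finally show ?thesis .
qed

text \<open>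
  Weighting the points of \<open>K\<close> by \<open>1 + s\<close> perturbs the Gram matrix of an orthonormal family, which
  is the identity, by \<open>s\<close> times the Gram matrix of the family restricted to \<open>K\<close>.
\<close>

lemma generating_function_count:
  assumes F: "finite F" and Z: "orthonormal F Z" and K: "K \<subseteq> F"
  shows "(\<Sum>S\<in>Pow F. of_real (det_weight F Z S) * (1 + s) ^ card (K \<inter> S))
    = leibniz {..<length Z} (\<lambda>i j. (if i = j then 1 else 0) + s * cinner K (Z ! i) (Z ! j))"
proof -
  let ?h = "\<lambda>x. 1 + (if x \<in> K then s else 0)"
  have gram: "(\<Sum>x\<in>F. ?h x * (Z ! i) x * cnj ((Z ! j) x))
      = (if i = j then 1 else 0) + s * cinner K (Z ! i) (Z ! j)"
    if "i < length Z" "j < length Z" for i j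
  proof -
    have "(\<Sum>x\<in>F. ?h x * (Z ! i) x * cnj ((Z ! j) x))
        = cinner F (Z ! i) (Z ! j) + (\<Sum>x\<in>F. if x \<in> K then s * ((Z ! i) x * cnj ((Z ! j) x)) else 0)"
      unfolding cinner_def sum.distrib[symmetric] by (intro sum.cong) (auto simp: algebra_simps)
    also have "(\<Sum>x\<in>F. if x \<in> K then s * ((Z ! i) x * cnj ((Z ! j) x)) else 0)
        = s * cinner K (Z ! i) (Z ! j)"
      using F K by (simp add: cinner_def sum_distrib_left Int_absorb1 flip: sum.inter_restrict)
    finally show ?thesis using Z that by (simp add: orthonormal_def)
  qed
  have "(\<Prod>x\<in>S. ?h x) = (1 + s) ^ card (K \<inter> S)" if "S \<in> Pow F" for S
  proof -
    have finS: "finite S" using that F finite_subset by blast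
    have "(\<Prod>x\<in>S. ?h x) = (\<Prod>x\<in>S \<inter> K. 1 + s)"
      unfolding prod.inter_restrict[OF finS] by (intro prod.cong) auto
    then show ?thesis by (simp add: Int_commute)
  qed
  then have "(\<Sum>S\<in>Pow F. of_real (det_weight F Z S) * (1 + s) ^ card (K \<inter> S))
      = leibniz {..<length Z} (\<lambda>i j. \<Sum>x\<in>F. ?h x * (Z ! i) x * cnj ((Z ! j) x))"
    using generating_function[OF F, of Z ?h] by simp
  also have "\<dots> = leibniz {..<length Z} (\<lambda>i j. (if i = j then 1 else 0) + s * cinner K (Z ! i) (Z ! j))"
    by (rule leibniz_cong) (use gram in simp)
  finally show ?thesis .
qed

lemma coefficient_eqI:
  fixes f :: "'b \<Rightarrow> complex" and g :: "'c \<Rightarrow> complex"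
  assumes A: "finite A" and B: "finite B"
    and eq: "\<And>t. (\<Sum>x\<in>A. f x * t ^ c x) = (\<Sum>y\<in>B. g y * t ^ d y)"
  shows "(\<Sum>x | x \<in> A \<and> c x = k. f x) = (\<Sum>y | y \<in> B \<and> d y = k. g y)"
proof -
  \<comment> \<open>A crude bound for \<open>k\<close> and all exponents.\<close>
  define M where "M = k + sum c A + sum d B"
  have collect: "(\<Sum>x\<in>X. h x * t ^ e x) = (\<Sum>l\<le>M. (\<Sum>x | x \<in> X \<and> e x = l. h x) * t ^ l)"
    if "finite X" "sum e X \<le> M" for X :: "'d set" and h and e and t :: complex
  proof -
    have "e x \<le> M" if "x \<in> X" for x
      using member_le_sum[of x X e] that \<open>finite X\<close> \<open>sum e X \<le> M\<close> by simp
    then have "(\<Sum>x\<in>X. h x * t ^ e x) = (\<Sum>l\<le>M. \<Sum>x | x \<in> X \<and> e x = l. h x * t ^ e x)"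
      using \<open>finite X\<close> by (intro sum.group[symmetric]) auto
    then show ?thesis by (simp add: sum_distrib_right)
  qed
  have "\<forall>t. (\<Sum>l\<le>M. (\<Sum>x | x \<in> A \<and> c x = l. f x) * t ^ l) = (\<Sum>l\<le>M. (\<Sum>y | y \<in> B \<and> d y = l. g y) * t ^ l)"
    using collect[OF A, of c f] collect[OF B, of d g] eq by (simp add: M_def)
  then show ?thesis unfolding polyfun_eq_coeffs by (simp add: M_def)
qed

section \<open>Inclusion probabilities\<close>

text \<open>
  The binomial theorem turns the law of the number of points in \<open>K\<close> into
  \<open>\<Sum>A\<in>Pow K. s ^ card A * P (A \<subseteq> \<phi>)\<close>, whose top coefficient is the inclusion probability of \<open>K\<close>;
  on the other side that coefficient is a sum of principal minors.  Every term is
  nonnegative and belongs to a subfamily of \<open>Z\<close>: deleting or shrinking vectors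
  can only decrease the sum.
\<close>

lemma inclusion_prob:
  assumes F: "finite F" and Z: "orthonormal F Z" and K: "K \<subseteq> F"
  shows "measure_pmf.prob (det_process F Z) {S. K \<subseteq> S}
    = (\<Sum>T | T \<subseteq> {..<length Z} \<and> card T = card K. Re (leibniz T (\<lambda>i j. cinner K (Z ! i) (Z ! j))))"
proof -
  define m where "m = length Z"
  define G where "G i j = cinner K (Z ! i) (Z ! j)" for i j
  define P :: "nat set \<Rightarrow> complex" where "P A = (\<Sum>S | S \<in> Pow F \<and> A \<subseteq> S. of_real (det_weight F Z S))" for A
  have finK: "finite K" using F K finite_subset by blast
  have expand: "(\<Sum>A\<in>Pow K. P A * s ^ card A) = (\<Sum>T\<in>Pow {..<m}. leibniz T G * s ^ card T)" for s
  proof -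
    have binomial: "(1 + s) ^ card (K \<inter> S) = (\<Sum>A | A \<in> Pow K \<and> A \<subseteq> S. s ^ card A)" for S
    proof -
      have "(1 + s) ^ card (K \<inter> S) = (\<Prod>x\<in>K \<inter> S. s + 1)" by (simp add: add.commute)
      also have "\<dots> = (\<Sum>A\<in>Pow (K \<inter> S). s ^ card A)"
        using finK by (subst prod_add) simp_all
      also have "Pow (K \<inter> S) = {A. A \<in> Pow K \<and> A \<subseteq> S}" by auto
      finally show ?thesis .
    qed
    have "(\<Sum>S\<in>Pow F. of_real (det_weight F Z S) * (1 + s) ^ card (K \<inter> S))
        = (\<Sum>S\<in>Pow F. \<Sum>A | A \<in> Pow K \<and> A \<subseteq> S. of_real (det_weight F Z S) * s ^ card A)"
      by (simp add: binomial sum_distrib_left)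
    also have "\<dots> = (\<Sum>A\<in>Pow K. P A * s ^ card A)"
      unfolding P_def sum_distrib_right by (rule sum.swap_restrict) (use F finK in auto)
    finally show ?thesis
      using generating_function_count[OF F Z K, of s]
      by (simp add: leibniz_one_plus m_def G_def[abs_def] mult.commute)
  qed
  have "(\<Sum>A | A \<in> Pow K \<and> card A = card K. P A)
      = (\<Sum>T | T \<in> Pow {..<m} \<and> card T = card K. leibniz T G)"
    by (rule coefficient_eqI) (use finK expand in simp_all)
  also have "{A. A \<in> Pow K \<and> card A = card K} = {K}"
    using card_subset_eq[OF finK] by auto
  finally have "P K = (\<Sum>T | T \<in> Pow {..<m} \<and> card T = card K. leibniz T G)" by simp
  moreover have "P K = of_real (measure_pmf.prob (det_process F Z) {S. K \<subseteq> S})"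
    unfolding P_def measure_det_process[OF F Z] of_real_sum by (rule sum.cong) auto
  ultimately have "of_real (measure_pmf.prob (det_process F Z) {S. K \<subseteq> S})
      = (\<Sum>T | T \<in> Pow {..<m} \<and> card T = card K. leibniz T G)" by simp
  from arg_cong[OF this, of Re] show ?thesis
    by (simp add: G_def[abs_def] m_def)
qed

section \<open>Independence of the basis\<close>

lemma cinner_sum_left:
  assumes "\<And>x. f x = (\<Sum>j\<in>A. a j * g j x)"
  shows "cinner F f h = (\<Sum>j\<in>A. a j * cinner F (g j) h)"
proof -
  have "cinner F f h = (\<Sum>x\<in>F. \<Sum>j\<in>A. a j * (g j x * cnj (h x)))"
    by (simp add: cinner_def assms sum_distrib_right mult.assoc)
  also have "\<dots> = (\<Sum>j\<in>A. \<Sum>x\<in>F. a j * (g j x * cnj (h x)))"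
    by (rule sum.swap)
  finally show ?thesis by (simp add: cinner_def sum_distrib_left)
qed

lemma orthonormal_expand:
  assumes B: "orthonormal_basis F E B" and f: "f \<in> E"
  shows "f x = (\<Sum>j<length B. cinner F f (B ! j) * (B ! j) x)"
proof -
  define S where "S = {f. \<forall>x. f x = (\<Sum>j<length B. cinner F f (B ! j) * (B ! j) x)}"
  have add: "cinner F (f + g) h = cinner F f h + cinner F g h" for f g h
    by (simp add: cinner_def sum.distrib distrib_right)
  have scale: "cinner F (cscale c f) h = c * cinner F f h" for c f h
    by (simp add: cinner_def cscale_def sum_distrib_left mult.assoc)
  have "cvec.subspace S"
  proof (rule cvec.subspaceI)
    show "0 \<in> S" by (simp add: S_def cinner_def)
  next
    fix f g assume "f \<in> S" "g \<in> S"
    then show "f + g \<in> S" by (simp add: S_def add distrib_right sum.distrib)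
  next
    fix c f assume "f \<in> S"
    then show "cscale c f \<in> S"
      by (simp add: S_def scale mult.assoc flip: sum_distrib_left) (simp add: cscale_def)
  qed
  moreover have "set B \<subseteq> S"
  proof
    fix b assume "b \<in> set B"
    then obtain i where i: "i < length B" "b = B ! i" by (auto simp: in_set_conv_nth)
    have "(\<Sum>j<length B. cinner F b (B ! j) * (B ! j) x) = b x" for x
    proof -
      have "(\<Sum>j<length B. cinner F b (B ! j) * (B ! j) x)
          = (\<Sum>j<length B. if j = i then (B ! j) x else 0)"
        using B i by (intro sum.cong) (auto simp: orthonormal_basis_def orthonormal_def)
      then show ?thesis using i by simp
    qed
    then show "b \<in> S" by (simp add: S_def)
  qed
  ultimately have "cvec.span (set B) \<subseteq> S" by (rule cvec.span_minimal[rotated])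
  then show ?thesis using B f by (auto simp: orthonormal_basis_def S_def)
qed

lemma orthonormal_basis_nth_mem:
  assumes "orthonormal_basis F E Z" "i < length Z"
  shows "Z ! i \<in> E"
  using assms cvec.span_superset[of "set Z"] by (auto simp: orthonormal_basis_def)

lemma parseval:
  assumes Z: "orthonormal_basis F E Z" and B: "orthonormal_basis F E B" and i: "i < length Z"
  shows "(\<Sum>j<length B. cinner F (Z ! i) (B ! j) * cinner F (B ! j) (Z ! i)) = 1"
proof -
  have "cinner F (Z ! i) (Z ! i)
      = (\<Sum>j<length B. cinner F (Z ! i) (B ! j) * cinner F (B ! j) (Z ! i))"
    by (rule cinner_sum_left) (rule orthonormal_expand[OF B orthonormal_basis_nth_mem[OF Z i]])
  then show ?thesis
    using Z i by (simp add: orthonormal_basis_def orthonormal_def)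
qed

text \<open>
  The sum of all squared moduli \<open>|\<langle>Z ! i, B ! j\<rangle>|\<^sup>2\<close> equals either length, by Parseval's identity
  applied to each vector of one basis in terms of the other.
\<close>

lemma orthonormal_basis_length_eq:
  assumes Z: "orthonormal_basis F E Z" and B: "orthonormal_basis F E B"
  shows "length Z = length B"
proof -
  have "of_nat (length Z) =
      (\<Sum>i<length Z. \<Sum>j<length B. cinner F (Z ! i) (B ! j) * cinner F (B ! j) (Z ! i))"
    by (simp add: parseval[OF Z B])
  also have "\<dots> = (\<Sum>j<length B. \<Sum>i<length Z. cinner F (B ! j) (Z ! i) * cinner F (Z ! i) (B ! j))"
    by (subst sum.swap) (simp add: mult.commute)
  also have "\<dots> = of_nat (length B)"
    by (simp add: parseval[OF B Z])
  finally show ?thesis by (simp only: of_nat_eq_iff)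
qed

text \<open>
  A change of basis multiplies all minors by the same determinant.  Its squared modulus is one
  because both families of weights sum to one.
\<close>

lemma det_process_basis_independent:
  assumes F: "finite F" and Z: "orthonormal_basis F E Z" and B: "orthonormal_basis F E B"
  shows "det_process F Z = det_process F B"
proof -
  define m where "m = length B"
  have len: "length Z = m" using orthonormal_basis_length_eq[OF Z B] by (simp add: m_def)
  define A where "A = Matrix.mat m m (\<lambda>(i, j). cinner F (Z ! i) (B ! j))"
  have A: "A \<in> carrier_mat m m" by (simp add: A_def)
  have minor: "minor_mat Z g = A * minor_mat B g" for g
  proof (rule eq_matI)
    fix i j assume "i < dim_row (A * minor_mat B g)" "j < dim_col (A * minor_mat B g)"
    then have ij: "i < m" "j < m" by (simp_all add: A_def minor_mat_def m_def)
    have "(A * minor_mat B g) $$ (i, j) = (\<Sum>k<m. cinner F (Z ! i) (B ! k) * (B ! k) (g j))"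
      using ij by (simp add: A_def minor_mat_def m_def scalar_prod_def atLeast0LessThan)
    also have "\<dots> = (Z ! i) (g j)"
      using orthonormal_expand[OF B orthonormal_basis_nth_mem[OF Z], of i "g j"] ij
      by (simp add: m_def len)
    finally show "minor_mat Z g $$ (i, j) = (A * minor_mat B g) $$ (i, j)"
      using ij by (simp add: minor_mat_def len)
  qed (simp_all add: A_def minor_mat_def len m_def)
  have scaled: "det_weight F Z S = (cmod (Determinant.det A))\<^sup>2 * det_weight F B S" for S
    using det_mult[OF A, of "minor_mat B ((!) (sorted_list_of_set S))"] minor_mat_carrier[of B]
    by (simp add: det_weight_def minor len m_def norm_mult power_mult_distrib)
  have "1 = (cmod (Determinant.det A))\<^sup>2 * (\<Sum>S\<in>Pow F. det_weight F B S)"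
    using sum_det_weight[OF F, of Z] Z by (simp add: scaled orthonormal_basis_def sum_distrib_left)
  then have "(cmod (Determinant.det A))\<^sup>2 = 1"
    using sum_det_weight[OF F, of B] B by (simp add: orthonormal_basis_def)
  then have "det_weight F Z = det_weight F B" using scaled by auto
  then show ?thesis by (simp add: det_process_def)
qed

lemma cinner_cspace:
  assumes "finite F" "H \<subseteq> F" "f \<in> cspace H"
  shows "cinner F f g = cinner H f g"
  unfolding cinner_def
  by (rule sum.mono_neutral_right) (use assms in \<open>auto simp: cspace_def\<close>)

lemma orthonormal_appendD2:
  assumes F: "finite F" and XW: "orthonormal F (X @ W)" and W: "set W \<subseteq> cspace H" and H: "H \<subseteq> F"
  shows "orthonormal H W"
  unfolding orthonormal_def
proof (intro conjI allI impI W)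
  fix i j assume ij: "i < length W" "j < length W"
  have "cinner H (W ! i) (W ! j) = cinner F (W ! i) (W ! j)"
    using cinner_cspace[OF F H, of "W ! i"] W ij by (simp add: subset_iff)
  also have "\<dots> = cinner F ((X @ W) ! (length X + i)) ((X @ W) ! (length X + j))"
    by (simp only: nth_append_length_plus)
  also have "\<dots> = (if length X + i = length X + j then 1 else 0)"
    using XW[unfolded orthonormal_def, THEN conjunct2, rule_format, of "length X + i" "length X + j"] ij
    by (simp only: length_append add_less_cancel_left)
  also have "\<dots> = (if i = j then 1 else 0)" by simp
  finally show "cinner H (W ! i) (W ! j) = (if i = j then 1 else 0)" .
qed

lemma orthonormal_append_commute:
  assumes "orthonormal F (X @ Y)"
  shows "orthonormal F (Y @ X)"
  unfolding orthonormal_def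
proof (intro conjI allI impI)
  show "set (Y @ X) \<subseteq> cspace F" using assms by (auto simp: orthonormal_def)
next
  fix i j assume ij: "i < length (Y @ X)" "j < length (Y @ X)"
  let ?r = "\<lambda>i. if i < length Y then length X + i else i - length Y"
  have r: "(Y @ X) ! i = (X @ Y) ! ?r i" "?r i < length (X @ Y)" if "i < length (Y @ X)" for i
    using that by (auto simp: nth_append)
  have "cinner F ((Y @ X) ! i) ((Y @ X) ! j) = cinner F ((X @ Y) ! ?r i) ((X @ Y) ! ?r j)"
    using r(1)[OF ij(1)] r(1)[OF ij(2)] by (simp only:)
  also have "\<dots> = (if ?r i = ?r j then 1 else 0)"
    using assms r(2)[OF ij(1)] r(2)[OF ij(2)] unfolding orthonormal_def by blast
  also have "?r i = ?r j \<longleftrightarrow> i = j" using ij by auto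
  finally show "cinner F ((Y @ X) ! i) ((Y @ X) ! j) = (if i = j then 1 else 0)" .
qed

section \<open>The number of points in a set\<close>

text \<open>
  If the Gram matrix on \<open>J\<close> is diagonal, the generating function of the number of points in \<open>J\<close> is
  the product of the factors \<open>t * a i + (1 - a i)\<close>: that number is distributed as a sum of
  independent Bernoulli variables with parameters \<open>a i\<close>.
\<close>

lemma count_prob:
  assumes F: "finite F" and Z: "orthonormal F Z" and J: "J \<subseteq> F" and n: "n \<le> length Z"
    and diag: "\<And>i j. i < length Z \<Longrightarrow> j < length Z \<Longrightarrow>
      cinner J (Z ! i) (Z ! j) = (if i = j \<and> i < n then of_real (a i) else 0)"
  shows "measure_pmf.prob (det_process F Z) {S. card (J \<inter> S) = k}
    = (\<Sum>I | I \<subseteq> {..<n} \<and> card I = k. (\<Prod>i\<in>I. a i) * (\<Prod>i\<in>{..<n} - I. 1 - a i))"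
proof -
  let ?c = "\<lambda>I. (\<Prod>i\<in>I. a i) * (\<Prod>i\<in>{..<n} - I. 1 - a i)"
  have expand: "(\<Sum>S\<in>Pow F. of_real (det_weight F Z S) * t ^ card (J \<inter> S))
      = (\<Sum>I\<in>Pow {..<n}. of_real (?c I) * t ^ card I)" for t :: complex
  proof -
    let ?d = "\<lambda>i. if i < n then of_real (a i) else (0::complex)"
    have "(\<Sum>S\<in>Pow F. of_real (det_weight F Z S) * t ^ card (J \<inter> S))
        = leibniz {..<length Z} (\<lambda>i j. (if i = j then 1 else 0) + (t - 1) * cinner J (Z ! i) (Z ! j))"
      using generating_function_count[OF F Z J, of "t - 1"] by simp
    also have "\<dots> = (\<Prod>i<length Z. 1 + (t - 1) * ?d i)"
      by (subst leibniz_diagonal) (auto simp: diag intro!: prod.cong)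
    also have "\<dots> = (\<Prod>i<n. 1 + (t - 1) * ?d i)"
      by (rule prod.mono_neutral_right) (use n in auto)
    also have "\<dots> = (\<Prod>i<n. t * of_real (a i) + of_real (1 - a i))"
      by (intro prod.cong) (auto simp: algebra_simps)
    also have "\<dots> = (\<Sum>I\<in>Pow {..<n}. of_real (?c I) * t ^ card I)"
      by (simp add: prod_add prod.distrib mult_ac)
    finally show ?thesis .
  qed
  have "(\<Sum>S | S \<in> Pow F \<and> card (J \<inter> S) = k. of_real (det_weight F Z S))
      = (\<Sum>I | I \<in> Pow {..<n} \<and> card I = k. complex_of_real (?c I))"
    by (rule coefficient_eqI) (use F expand in simp_all)
  then have "(\<Sum>S | S \<in> Pow F \<and> card (J \<inter> S) = k. det_weight F Z S)
      = (\<Sum>I | I \<in> Pow {..<n} \<and> card I = k. ?c I)"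
    unfolding of_real_sum[symmetric] of_real_eq_iff .
  moreover have "Pow F \<inter> {S. card (J \<inter> S) = k} = {S. S \<in> Pow F \<and> card (J \<inter> S) = k}" by auto
  ultimately show ?thesis
    by (simp add: measure_det_process[OF F Z])
qed

section \<open>Conditioning on inclusion and on exclusion\<close>

text \<open>
  Both laws have total mass one, which forces \<open>c = 1\<close>.  Applied to conditional laws, this takes care
  of the normalising constants.
\<close>

lemma pmf_eqI_proportional:
  assumes "\<And>x. pmf p x = c * pmf q x"
  shows "p = q"
proof -
  have "infsetsum (pmf p) UNIV = c * infsetsum (pmf q) UNIV"
    unfolding assms[abs_def] by (rule infsetsum_cmult_right) (simp add: pmf_abs_summable)
  then have "c = 1" by (simp add: infsetsum_pmf_eq_1)
  then show ?thesis using assms by (intro pmf_eqI) simp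
qed

text \<open>
  Listing \<open>J\<close> first, the minor of \<open>X @ W\<close> at \<open>S\<close> is block triangular, because \<open>W\<close> vanishes on \<open>J\<close>
  and \<open>X\<close> has as many vectors as \<open>J\<close> has points.  The block on \<open>J\<close> is the same for every \<open>S\<close>.
\<close>

lemma det_weight_block_triangular:
  assumes F: "finite F" and J: "J \<subseteq> F" and X: "length X = card J"
    and W: "\<And>w x. w \<in> set W \<Longrightarrow> x \<in> J \<Longrightarrow> w x = 0" and S: "J \<subseteq> S" 
  shows "det_weight F (X @ W) S
    = (cmod (Determinant.det (minor_mat X ((!) (sorted_list_of_set J)))))\<^sup>2 * det_weight (F - J) W (S - J)"
proof (cases "S \<subseteq> F \<and> card S = length (X @ W)")
  case False
  have "\<not> (S - J \<subseteq> F - J \<and> card (S - J) = length W)"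
  proof
    assume *: "S - J \<subseteq> F - J \<and> card (S - J) = length W"
    then have "S \<subseteq> F" using J S by blast
    then have "finite S" using F finite_subset by blast
    then have "card S = card J + card (S - J)"
      using S finite_subset[OF S] card_mono[of S J] by (simp add: card_Diff_subset)
    then show False using False * \<open>S \<subseteq> F\<close> X by simp
  qed
  then show ?thesis using False by (auto simp: det_weight_def)
next
  case True
  define a where "a = (!) (sorted_list_of_set J)"
  define b where "b = (!) (sorted_list_of_set (S - J))"
  define g where "g j = (if j < length X then a j else b (j - length X))" for j
  let ?n = "length X" and ?m = "length W"
  have finS: "finite S" using True finite_subset[OF _ F] by simp
  have finJ: "finite J" by (rule finite_subset[OF S finS])
  have cardSJ: "card (S - J) = ?m"
    using True X S finJ by (simp add: card_Diff_subset)
  have a: "bij_betw a {..<?n} J"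
    unfolding a_def by (rule bij_betw_nth) (use finJ X in simp_all)
  have b: "bij_betw b {..<?m} (S - J)"
    unfolding b_def by (rule bij_betw_nth) (use finS cardSJ in simp_all)
  have "bij_betw (\<lambda>j. b (j - ?n)) {?n..<?n + ?m} (S - J)"
    by (rule bij_betw_trans[of "\<lambda>j. j - ?n" _ "{..<?m}", unfolded o_def, OF _ b])
       (rule bij_betwI[where g = "\<lambda>j. j + ?n"]; auto)
  then have "bij_betw g {?n..<?n + ?m} (S - J)"
    by (rule iffD1[OF bij_betw_cong, rotated]) (simp add: g_def)
  moreover have "bij_betw g {..<?n} J"
    by (rule iffD1[OF bij_betw_cong a]) (simp add: g_def)
  ultimately have "bij_betw g ({..<?n} \<union> {?n..<?n + ?m}) (J \<union> (S - J))"
    by (intro bij_betw_combine) auto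
  moreover have "{..<?n} \<union> {?n..<?n + ?m} = {..<length (X @ W)}" "J \<union> (S - J) = S"
    using S by auto
  ultimately have g: "bij_betw g {..<length (X @ W)} S" by simp
  have zero: "(W ! i) (a j) = 0" if "i < ?m" "j < ?n" for i j
    using W[of "W ! i" "a j"] that bij_betw_apply[OF a] by simp
  have "minor_mat (X @ W) g = four_block_mat (minor_mat X a)
      (Matrix.mat ?n ?m (\<lambda>(i, j). (X ! i) (b j))) (0\<^sub>m ?m ?n) (minor_mat W b)"
    by (rule eq_matI) (auto simp: minor_mat_def nth_append g_def zero)
  then have "Determinant.det (minor_mat (X @ W) g)
      = Determinant.det (minor_mat X a) * Determinant.det (minor_mat W b)"
    using det_four_block_mat_lower_left_zero[of "minor_mat X a" ?n _ ?m _ "minor_mat W b"] by simp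
  moreover have "det_weight (F - J) W (S - J) = (cmod (Determinant.det (minor_mat W b)))\<^sup>2"
    by (rule det_weight_enumeration[OF b]) (use True in auto)
  moreover have "det_weight F (X @ W) S = (cmod (Determinant.det (minor_mat (X @ W) g)))\<^sup>2"
    by (rule det_weight_enumeration[OF g]) (use True in simp)
  ultimately show ?thesis
    by (simp add: a_def norm_mult power_mult_distrib)
qed

lemma pmf_cond_pos:
  assumes "measure_pmf.prob p A > 0"
  shows "pmf (cond_pmf p A) x = (if x \<in> A then pmf p x / measure_pmf.prob p A else 0)"
    and "set_pmf (cond_pmf p A) \<subseteq> A"
proof -
  have ne: "set_pmf p \<inter> A \<noteq> {}"
    using assms by (metis Int_commute measure_Int_set_pmf measure_empty less_irrefl)
  show "pmf (cond_pmf p A) x = (if x \<in> A then pmf p x / measure_pmf.prob p A else 0)"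
    by (rule pmf_cond[OF ne])
  show "set_pmf (cond_pmf p A) \<subseteq> A" by (simp add: set_cond_pmf[OF ne])
qed

text \<open>
  Both laws are proportional, since the block on \<open>J\<close> contributes a constant factor to every weight.
\<close>

lemma conditioned_on_inclusion:
  assumes F: "finite F" and XW: "orthonormal F (X @ W)" and J: "J \<subseteq> F" and X: "length X = card J"
    and W: "set W \<subseteq> cspace (F - J)"
    and pos: "measure_pmf.prob (det_process F (X @ W)) {S. J \<subseteq> S} > 0"
  shows "map_pmf (\<lambda>S. S - J) (cond_pmf (det_process F (X @ W)) {S. J \<subseteq> S}) = det_process (F - J) W"
proof -
  let ?q = "cond_pmf (det_process F (X @ W)) {S. J \<subseteq> S}"
  define P where "P = measure_pmf.prob (det_process F (X @ W)) {S. J \<subseteq> S}"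
  define C where "C = (cmod (Determinant.det (minor_mat X ((!) (sorted_list_of_set J)))))\<^sup>2"
  have oW: "orthonormal (F - J) W" by (rule orthonormal_appendD2[OF F XW W]) simp
  have W0: "w x = 0" if "w \<in> set W" "x \<in> J" for w x
    using W that by (auto simp: cspace_def)
  have "pmf (map_pmf (\<lambda>S. S - J) ?q) T = C / P * pmf (det_process (F - J) W) T" for T
  proof -
    have "pmf (map_pmf (\<lambda>S. S - J) ?q) T
        = measure_pmf.prob ?q (if T \<inter> J = {} then {T \<union> J} else {})"
      unfolding pmf_map using pmf_cond_pos(2)[OF pos]
      by (intro measure_pmf.finite_measure_eq_AE) (auto simp: AE_measure_pmf_iff)
    also have "\<dots> = C / P * det_weight (F - J) W T"
    proof (cases "T \<inter> J = {}")
      case True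
      then have "T \<union> J - J = T" by auto
      then have "det_weight F (X @ W) (T \<union> J) = C * det_weight (F - J) W T"
        using det_weight_block_triangular[OF F J X, of W "T \<union> J"] W0 by (simp add: C_def)
      then show ?thesis
        using True pmf_det_process[OF F XW, of "T \<union> J"]
        by (simp add: measure_pmf_single pmf_cond_pos(1)[OF pos] P_def)
    next
      case False
      then have "\<not> T \<subseteq> F - J" by auto
      then show ?thesis using False by (auto simp: det_weight_def)
    qed
    finally show ?thesis by (simp add: pmf_det_process[OF _ oW] F)
  qed
  then show ?thesis by (rule pmf_eqI_proportional)
qed

lemma det_minor_mat_scale:
  assumes len: "length Y = length Z"
    and Z: "\<And>i j. i < length Z \<Longrightarrow> j < length Z \<Longrightarrow> (Z ! i) (g j) = a i * (Y ! i) (g j)"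
  shows "Determinant.det (minor_mat Z g) = (\<Prod>i<length Z. a i) * Determinant.det (minor_mat Y g)"
proof -
  have "leibniz {..<length Z} (\<lambda>j k. (Z ! k) (g j)) = leibniz {..<length Z} (\<lambda>j k. 1 * a k * (Y ! k) (g j))"
    by (rule leibniz_cong) (simp add: Z)
  also have "\<dots> = (\<Prod>i<length Z. a i) * leibniz {..<length Z} (\<lambda>j k. (Y ! k) (g j))"
    by (subst leibniz_scale) simp
  finally show ?thesis by (simp add: det_minor_mat_eq_leibniz len)
qed

text \<open>
  On subsets of \<open>F - J\<close> the minors of \<open>Z\<close> are those of \<open>Y\<close> with scaled rows, so that all weights
  carry the same factor.
\<close>

lemma conditioned_on_exclusion:
  assumes F: "finite F" and Z: "orthonormal F Z" and Y: "orthonormal (F - J) Y"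
    and len: "length Y = length Z"
    and scale: "\<And>i x. i < length Z \<Longrightarrow> x \<in> F - J \<Longrightarrow> (Z ! i) x = a i * (Y ! i) x"
    and pos: "measure_pmf.prob (det_process F Z) {S. J \<subseteq> F - S} > 0" and J: "J \<subseteq> F"
  shows "cond_pmf (det_process F Z) {S. J \<subseteq> F - S} = det_process (F - J) Y"
proof -
  define P where "P = measure_pmf.prob (det_process F Z) {S. J \<subseteq> F - S}"
  define C where "C = (cmod (\<Prod>i<length Z. a i))\<^sup>2"
  have weight: "det_weight F Z S = C * det_weight (F - J) Y S" if JS: "J \<subseteq> F - S" for S
  proof (cases "S \<subseteq> F \<and> card S = length Z")
    case True
    then have SJ: "S \<subseteq> F - J" using JS by auto
    then have "finite S" using F finite_subset by blast
    then have "sorted_list_of_set S ! j \<in> F - J" if "j < length Z" for j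
      using nth_mem[of j "sorted_list_of_set S"] True that SJ by auto
    then show ?thesis
      using True SJ det_minor_mat_scale[OF len, of "(!) (sorted_list_of_set S)" a] scale
      by (simp add: det_weight_def C_def len norm_mult power_mult_distrib)
  qed (auto simp: det_weight_def len)
  have "pmf (cond_pmf (det_process F Z) {S. J \<subseteq> F - S}) S = C / P * pmf (det_process (F - J) Y) S" for S
  proof (cases "J \<subseteq> F - S")
    case False
    then have "\<not> S \<subseteq> F - J" using J by auto
    then show ?thesis using False
      by (simp add: pmf_cond_pos(1)[OF pos] pmf_det_process[OF _ Y] F det_weight_def)
  qed (simp add: pmf_cond_pos(1)[OF pos] pmf_det_process[OF _ Y] F pmf_det_process[OF F Z] weight P_def)
  then show ?thesis by (rule pmf_eqI_proportional)
qed

section \<open>Comparison of inclusion probabilities\<close>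

text \<open>
  The principal minors for \<open>W\<close> form part of the sum of nonnegative principal minors for \<open>X @ W\<close>.
\<close>

lemma inclusion_prob_append_mono:
  assumes F: "finite F" and XW: "orthonormal F (X @ W)" and W: "set W \<subseteq> cspace H" and H: "H \<subseteq> F"
    and K: "K \<subseteq> H"
  shows "measure_pmf.prob (det_process H W) {S. K \<subseteq> S}
    \<le> measure_pmf.prob (det_process F (X @ W)) {S. K \<subseteq> S}"
proof -
  let ?f = "\<lambda>Z T. Re (leibniz T (\<lambda>i j. cinner K (Z ! i) (Z ! j)))"
  have finH: "finite H" and finK: "finite K"
    using finite_subset[OF H F] finite_subset[OF K] by auto
  have fin: "finite T" if "T \<subseteq> {..<l}" for T and l :: nat using finite_subset[OF that] by simp
  \<comment> \<open>With \<open>W\<close> in front, the subsets of indices of \<open>W\<close> are literally subsets of the indices of the whole family.\<close>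
  have WX: "orthonormal F (W @ X)" by (rule orthonormal_append_commute[OF XW])
  have law: "det_process F (X @ W) = det_process F (W @ X)"
    by (rule det_process_basis_independent[OF F, where E = "cvec.span (set (X @ W))"])
       (use XW WX in \<open>simp_all add: orthonormal_basis_def Un_commute\<close>)
  have "measure_pmf.prob (det_process H W) {S. K \<subseteq> S} = (\<Sum>T | T \<subseteq> {..<length W} \<and> card T = card K. ?f W T)"
    by (rule inclusion_prob[OF finH orthonormal_appendD2[OF F XW W H] K])
  also have "\<dots> = (\<Sum>T | T \<subseteq> {..<length W} \<and> card T = card K. ?f (W @ X) T)"
    by (intro sum.cong refl arg_cong[of _ _ Re] leibniz_cong) (auto simp: nth_append)
  also have "\<dots> \<le> (\<Sum>T | T \<subseteq> {..<length (W @ X)} \<and> card T = card K. ?f (W @ X) T)"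
    using leibniz_gram_nonneg[OF fin finK, of _ _ "(!) (W @ X)"]
    by (intro sum_mono2) (auto simp: cinner_def)
  also have "\<dots> = measure_pmf.prob (det_process F (W @ X)) {S. K \<subseteq> S}"
    by (rule inclusion_prob[OF F WX, symmetric]) (use H K in auto)
  finally show ?thesis by (simp add: law)
qed

text \<open>
  Replacing \<open>Y\<close> by \<open>Z\<close> scales the rows and columns of the Gram matrix on \<open>K\<close>, which multiplies each
  principal minor by \<open>\<Prod>i\<in>T. (a i)\<^sup>2 \<le> 1\<close>.
\<close>

lemma inclusion_prob_scale_mono:
  fixes a :: "nat \<Rightarrow> real"
  assumes F: "finite F" and Z: "orthonormal F Z" and Y: "orthonormal H Y" and H: "H \<subseteq> F"
    and len: "length Y = length Z"
    and scale: "\<And>i x. i < length Z \<Longrightarrow> x \<in> H \<Longrightarrow> (Z ! i) x = of_real (a i) * (Y ! i) x"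
    and a: "\<And>i. i < length Z \<Longrightarrow> (a i)\<^sup>2 \<le> 1" and K: "K \<subseteq> H"
  shows "measure_pmf.prob (det_process F Z) {S. K \<subseteq> S} \<le> measure_pmf.prob (det_process H Y) {S. K \<subseteq> S}"
proof -
  let ?f = "\<lambda>Z T. Re (leibniz T (\<lambda>i j. cinner K (Z ! i) (Z ! j)))"
  have finH: "finite H" and finK: "finite K"
    using finite_subset[OF H F] finite_subset[OF K] by auto
  have "measure_pmf.prob (det_process F Z) {S. K \<subseteq> S} = (\<Sum>T | T \<subseteq> {..<length Z} \<and> card T = card K. ?f Z T)"
    by (rule inclusion_prob[OF F Z]) (use H K in auto)
  also have "\<dots> \<le> (\<Sum>T | T \<subseteq> {..<length Z} \<and> card T = card K. ?f Y T)"
  proof (rule sum_mono)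
    fix T assume "T \<in> {T. T \<subseteq> {..<length Z} \<and> card T = card K}"
    then have T: "T \<subseteq> {..<length Z}" by simp
    have "leibniz T (\<lambda>i j. cinner K (Z ! i) (Z ! j))
        = leibniz T (\<lambda>i j. of_real (a i) * of_real (a j) * cinner K (Y ! i) (Y ! j))"
    proof (rule leibniz_cong)
      fix i j assume "i \<in> T" "j \<in> T"
      then show "cinner K (Z ! i) (Z ! j) = of_real (a i) * of_real (a j) * cinner K (Y ! i) (Y ! j)"
        using T K unfolding cinner_def sum_distrib_left
        by (intro sum.cong refl) (auto simp: scale subset_iff)
    qed
    also have "\<dots> = of_real (\<Prod>i\<in>T. (a i)\<^sup>2) * leibniz T (\<lambda>i j. cinner K (Y ! i) (Y ! j))"
      unfolding leibniz_scale by (simp add: power2_eq_square)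
    finally have gram: "leibniz T (\<lambda>i j. cinner K (Z ! i) (Z ! j)) = \<dots>" .
    have "?f Z T = (\<Prod>i\<in>T. (a i)\<^sup>2) * ?f Y T"
      unfolding gram by (simp del: of_real_prod of_real_power)
    also have "\<dots> \<le> 1 * ?f Y T"
    proof (rule mult_right_mono)
      show "(\<Prod>i\<in>T. (a i)\<^sup>2) \<le> 1" using a T by (intro prod_le_1) auto
      show "0 \<le> ?f Y T"
        using leibniz_gram_nonneg[OF finite_subset[OF T] finK, of "(!) Y"] by (simp add: cinner_def)
    qed
    finally show "?f Z T \<le> ?f Y T" by simp
  qed
  also have "\<dots> = measure_pmf.prob (det_process H Y) {S. K \<subseteq> S}"
    using inclusion_prob[OF finH Y K] by (simp add: len)
  finally show ?thesis .
qed

section \<open>The law of the process in the basis of the CS decomposition\<close>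

text \<open>
  The part of the CS decomposition that describes \<open>E\<close>, in a form common to the two cases: \<open>X\<close>
  collects the \<open>n\<close> vectors built from \<open>u\<close>.  In the case \<open>p + n > N\<close> the first \<open>n + p - N\<close> of them have no
  component outside \<open>J\<close>; their angles vanish, so that they still fit the pattern
  \<open>cos \<theta>\<^sub>i\<close> times \<open>u\<^sub>i\<close> on \<open>J\<close>.
\<close>

lemma cs_decomposition_basis:
  fixes N p n :: nat
  assumes cs: "cs_decomposition N E J u \<theta> V W" and dim: "cvec.dim E = p"
    and card: "card J = n" and p: "p < N"
  obtains X where "length X = n" and "length W = p - n" and "orthonormal_basis {1..N} E (X @ W)"
    and "orthonormal ({1..N} - J) (V @ W)" and "set W \<subseteq> cspace ({1..N} - J)"
    and "\<And>i j. i < n \<Longrightarrow> j < n \<Longrightarrow>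
      cinner J (X ! i) (X ! j) = (if i = j then of_real ((cos (\<theta> ! i))\<^sup>2) else 0)"
    and "\<And>i x. p + n \<le> N \<Longrightarrow> i < n \<Longrightarrow> x \<in> {1..N} - J \<Longrightarrow>
      (X ! i) x = of_real (sin (\<theta> ! i)) * (V ! i) x"
    and "p + n \<le> N \<Longrightarrow> length V = n"
proof -
  let ?c = "\<lambda>i. complex_of_real (cos (\<theta> ! i))" and ?s = "\<lambda>i. complex_of_real (sin (\<theta> ! i))"
  define d where "d = n + p - N"
  define X where "X = (if p + n \<le> N
    then map (\<lambda>i. block J (cscale (?c i) (u ! i)) (cscale (?s i) (V ! i))) [0..<n]
    else map (\<lambda>i. block J (u ! i) 0) [0..<d]
      @ map (\<lambda>i. block J (cscale (?c i) (u ! i)) (cscale (?s i) (V ! (i - d)))) [d..<n])"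
  have u: "length u = n" "orthonormal J u" and VW: "orthonormal ({1..N} - J) (V @ W)"
    and W: "length W = p - n"
    using cs by (simp_all add: cs_decomposition_def Let_def dim card)
  have Wsub: "set W \<subseteq> cspace ({1..N} - J)" using VW by (auto simp: orthonormal_def)
  have "block J 0 w = w" if "w \<in> set W" for w
    using Wsub that by (auto simp: block_def cspace_def fun_eq_iff)
  then have mapW: "map (block J 0) W = W" by (simp add: map_idI)
  have basis: "orthonormal_basis {1..N} E (X @ W)"
    using cs by (simp add: cs_decomposition_def Let_def dim card X_def d_def mapW split: if_splits)
  have theta: "\<theta> ! i = 0" if "\<not> p + n \<le> N" "i < d" for i
    using cs that by (simp add: cs_decomposition_def Let_def dim card d_def)
  have d: "d \<le> n" using p by (simp add: d_def)
  have len: "length X = n" using d by (simp add: X_def)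
  have onJ: "(X ! i) x = ?c i * (u ! i) x" if "i < n" "x \<in> J" for i x
    using that d theta[of i] by (auto simp: X_def nth_append block_def cscale_def)
  show ?thesis
  proof (rule that[OF len W basis VW Wsub])
    fix i j assume ij: "i < n" "j < n"
    have "cinner J (X ! i) (X ! j) = ?c i * ?c j * cinner J (u ! i) (u ! j)"
      unfolding cinner_def sum_distrib_left by (intro sum.cong refl) (simp add: onJ ij)
    then show "cinner J (X ! i) (X ! j) = (if i = j then of_real ((cos (\<theta> ! i))\<^sup>2) else 0)"
      using u ij by (simp add: orthonormal_def power2_eq_square)
  next
    fix i x assume "p + n \<le> N" "i < n" "x \<in> {1..N} - J"
    then show "(X ! i) x = of_real (sin (\<theta> ! i)) * (V ! i) x"
      by (simp add: X_def block_def cscale_def)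
  next
    assume "p + n \<le> N"
    then show "length V = n" using cs by (simp add: cs_decomposition_def Let_def dim card)
  qed
qed

theorem proposition1:
  fixes N p n :: nat and E :: "cvec set" and J :: "nat set" and Z u V W :: "cvec list"
    and \<theta> :: "real list" and \<phi> :: "nat set pmf"
  assumes "1 < p" and "p < N"
    and "E \<subseteq> cspace {1..N}" and "cvec.subspace E" and "cvec.dim E = p"
    and "orthonormal_basis {1..N} E Z" and "\<phi> = det_process {1..N} Z"
    and "J \<subseteq> {1..N}" and "card J = n" and "1 \<le> n" and "n \<le> p"
    and "cs_decomposition N E J u \<theta> V W"
  shows
    "measure_pmf.prob \<phi> {S. card (J \<inter> S) = n} = (\<Prod>i<n. (cos (\<theta> ! i))\<^sup>2) \<and>
     (\<forall>k\<in>{1..n - 1}. measure_pmf.prob \<phi> {S. card (J \<inter> S) = k} =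
        (\<Sum>I | I \<subseteq> {..<n} \<and> card I = k.
           (\<Prod>i\<in>I. (cos (\<theta> ! i))\<^sup>2) * (\<Prod>i\<in>{..<n} - I. (sin (\<theta> ! i))\<^sup>2))) \<and>
     measure_pmf.prob \<phi> {S. card (J \<inter> ({1..N} - S)) = n} = (\<Prod>i<n. (sin (\<theta> ! i))\<^sup>2) \<and>
     (\<forall>k\<in>{1..n - 1}. measure_pmf.prob \<phi> {S. card (J \<inter> ({1..N} - S)) = k} =
        (\<Sum>I | I \<subseteq> {..<n} \<and> card I = k.
           (\<Prod>i\<in>I. (sin (\<theta> ! i))\<^sup>2) * (\<Prod>i\<in>{..<n} - I. (cos (\<theta> ! i))\<^sup>2))) \<and>
     (n < p \<and> measure_pmf.prob \<phi> {S. J \<subseteq> S} > 0 \<longrightarrow>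
        map_pmf (\<lambda>S. S - J) (cond_pmf \<phi> {S. J \<subseteq> S}) = det_process ({1..N} - J) W) \<and>
     (N - p > n \<and> measure_pmf.prob \<phi> {S. J \<subseteq> {1..N} - S} > 0 \<longrightarrow>
        cond_pmf \<phi> {S. J \<subseteq> {1..N} - S} = det_process ({1..N} - J) (V @ W)) \<and>
     (measure_pmf.prob \<phi> {S. J \<subseteq> S} > 0 \<longrightarrow>
        (\<forall>K \<subseteq> {1..N} - J.
           measure_pmf.prob (det_process ({1..N} - J) W) {S. K \<subseteq> S}
             \<le> measure_pmf.prob \<phi> {S. K \<subseteq> S})) \<and>
     (measure_pmf.prob \<phi> {S. J \<subseteq> {1..N} - S} > 0 \<longrightarrow>
        (\<forall>K \<subseteq> {1..N} - J.
           measure_pmf.prob \<phi> {S. K \<subseteq> S}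
             \<le> measure_pmf.prob (det_process ({1..N} - J) (V @ W)) {S. K \<subseteq> S}))"
proof -
  let ?F = "{1..N}"
  have pN: "p < N" and dim: "cvec.dim E = p" and card: "card J = n" and np: "n \<le> p"
    and J: "J \<subseteq> ?F" and Z: "orthonormal_basis ?F E Z" and \<phi>: "\<phi> = det_process ?F Z"
    and cs: "cs_decomposition N E J u \<theta> V W"
    using assms by simp_all
  obtain X where X: "length X = n" and W: "length W = p - n"
    and basis: "orthonormal_basis ?F E (X @ W)"
    and VW: "orthonormal (?F - J) (V @ W)" and Wsub: "set W \<subseteq> cspace (?F - J)"
    and cosX: "\<And>i j. i < n \<Longrightarrow> j < n \<Longrightarrow>
      cinner J (X ! i) (X ! j) = (if i = j then of_real ((cos (\<theta> ! i))\<^sup>2) else 0)"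
    and sinX: "\<And>i x. p + n \<le> N \<Longrightarrow> i < n \<Longrightarrow> x \<in> ?F - J \<Longrightarrow>
      (X ! i) x = of_real (sin (\<theta> ! i)) * (V ! i) x"
    and V: "p + n \<le> N \<Longrightarrow> length V = n"
    using cs_decomposition_basis[OF cs dim card pN] by blast
  have F: "finite ?F" by simp
  have finJ: "finite J" by (rule finite_subset[OF J F])
  have XW: "orthonormal ?F (X @ W)" using basis by (simp add: orthonormal_basis_def)
  have law: "\<phi> = det_process ?F (X @ W)"
    unfolding \<phi> by (rule det_process_basis_independent[OF F Z basis])
  have lenXW: "length (X @ W) = p" using X W np by simp
  have W0: "cinner J f (W ! i) = 0" "cinner J (W ! i) f = 0" if "i < length W" for f i
  proof -
    have "(W ! i) x = 0" if "x \<in> J" for x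
      using Wsub \<open>i < length W\<close> that by (auto simp: cspace_def subset_iff dest!: nth_mem)
    then show "cinner J f (W ! i) = 0" "cinner J (W ! i) f = 0" by (simp_all add: cinner_def)
  qed
  have count: "measure_pmf.prob \<phi> {S. card (J \<inter> S) = k} = (\<Sum>I | I \<subseteq> {..<n} \<and> card I = k.
      (\<Prod>i\<in>I. (cos (\<theta> ! i))\<^sup>2) * (\<Prod>i\<in>{..<n} - I. (sin (\<theta> ! i))\<^sup>2))" for k
  proof -
    have "cinner J ((X @ W) ! i) ((X @ W) ! j)
        = (if i = j \<and> i < n then of_real ((cos (\<theta> ! i))\<^sup>2) else 0)"
      if "i < length (X @ W)" "j < length (X @ W)" for i j
      using that X by (simp add: nth_append cosX W0 del: of_real_power)
    then show ?thesis
      using count_prob[OF F XW J, of n "\<lambda>i. (cos (\<theta> ! i))\<^sup>2" k] lenXW np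
      by (simp add: law sin_squared_eq)
  qed
  have count_compl: "measure_pmf.prob \<phi> {S. card (J \<inter> (?F - S)) = k} = (\<Sum>I | I \<subseteq> {..<n} \<and> card I = k.
      (\<Prod>i\<in>I. (sin (\<theta> ! i))\<^sup>2) * (\<Prod>i\<in>{..<n} - I. (cos (\<theta> ! i))\<^sup>2))" if k: "k \<le> n" for k
  proof -
    have "card (J \<inter> (?F - S)) = n - card (J \<inter> S) \<and> card (J \<inter> S) \<le> n" for S
    proof -
      have "J \<inter> (?F - S) = J - J \<inter> S" using J by auto
      then show ?thesis using finJ card card_mono[of J "J \<inter> S"] by (simp add: card_Diff_subset)
    qed
    then have "{S. card (J \<inter> (?F - S)) = k} = {S. card (J \<inter> S) = n - k}"
      using k by (metis (no_types, lifting) diff_diff_cancel)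
    then have "measure_pmf.prob \<phi> {S. card (J \<inter> (?F - S)) = k}
        = (\<Sum>I | I \<subseteq> {..<n} \<and> card I = n - k.
            (\<Prod>i\<in>I. (cos (\<theta> ! i))\<^sup>2) * (\<Prod>i\<in>{..<n} - I. (sin (\<theta> ! i))\<^sup>2))"
      by (simp add: count)
    also have "\<dots> = (\<Sum>I | I \<subseteq> {..<n} \<and> card I = k.
            (\<Prod>i\<in>I. (sin (\<theta> ! i))\<^sup>2) * (\<Prod>i\<in>{..<n} - I. (cos (\<theta> ! i))\<^sup>2))"
      by (rule sum.reindex_bij_witness[where i = "\<lambda>I. {..<n} - I" and j = "\<lambda>I. {..<n} - I"])
         (use k in \<open>auto simp: card_Diff_subset finite_subset double_diff mult.commute\<close>)
    finally show ?thesis .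
  qed
  have full: "{I. I \<subseteq> {..<n} \<and> card I = n} = {{..<n}}"
    using card_subset_eq[of "{..<n}"] by auto
  \<comment> \<open>When the process avoids \<open>J\<close>, its \<open>p\<close> points fit into the \<open>N - n\<close> points outside \<open>J\<close>.\<close>
  have small: "p + n \<le> N" if pos: "measure_pmf.prob \<phi> {S. J \<subseteq> ?F - S} > 0"
  proof (rule ccontr)
    assume *: "\<not> p + n \<le> N"
    have "det_weight ?F (X @ W) S = 0" if "J \<subseteq> ?F - S" for S
    proof -
      have False if S: "S \<subseteq> ?F" "card S = p"
      proof -
        have "S \<subseteq> ?F - J" using S \<open>J \<subseteq> ?F - S\<close> by auto
        then have "card S \<le> card (?F - J)" by (intro card_mono) auto
        then have "p \<le> N - n" using S J finJ card by (simp add: card_Diff_subset)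
        then show False using * \<open>1 < p\<close> by simp
      qed
      then have "\<not> (S \<subseteq> ?F \<and> card S = p)" by blast
      then show ?thesis by (simp only: det_weight_def lenXW if_False)
    qed
    then have "measure_pmf.prob \<phi> {S. J \<subseteq> ?F - S} = 0"
      unfolding law measure_det_process[OF F XW] by (intro sum.neutral) auto
    then show False using pos by simp
  qed
  \<comment> \<open>Outside \<open>J\<close> the CS basis is \<open>V @ W\<close> scaled by these numbers.\<close>
  define a where "a i = (if i < n then sin (\<theta> ! i) else 1)" for i
  have scale: "((X @ W) ! i) x = of_real (a i) * ((V @ W) ! i) x"
    if "p + n \<le> N" "i < length (X @ W)" "x \<in> ?F - J" for i x
    using that V X by (auto simp: nth_append a_def sinX)
  have a_le: "(a i)\<^sup>2 \<le> 1" for i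
    by (simp add: a_def abs_square_le_1)
  have lenVW: "length (V @ W) = length (X @ W)" if "p + n \<le> N"
    using V[OF that] X by simp
  show ?thesis
  proof (intro conjI impI ballI allI)
    show "measure_pmf.prob \<phi> {S. card (J \<inter> S) = n} = (\<Prod>i<n. (cos (\<theta> ! i))\<^sup>2)"
      by (simp add: count full)
    show "measure_pmf.prob \<phi> {S. card (J \<inter> (?F - S)) = n} = (\<Prod>i<n. (sin (\<theta> ! i))\<^sup>2)"
      using count_compl[of n] by (simp add: full)
    show "measure_pmf.prob \<phi> {S. card (J \<inter> S) = k} = (\<Sum>I | I \<subseteq> {..<n} \<and> card I = k.
        (\<Prod>i\<in>I. (cos (\<theta> ! i))\<^sup>2) * (\<Prod>i\<in>{..<n} - I. (sin (\<theta> ! i))\<^sup>2))" for k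
      by (rule count)
    show "measure_pmf.prob \<phi> {S. card (J \<inter> (?F - S)) = k} = (\<Sum>I | I \<subseteq> {..<n} \<and> card I = k.
        (\<Prod>i\<in>I. (sin (\<theta> ! i))\<^sup>2) * (\<Prod>i\<in>{..<n} - I. (cos (\<theta> ! i))\<^sup>2))"
      if "k \<in> {1..n - 1}" for k
      using that by (intro count_compl) auto
    show "map_pmf (\<lambda>S. S - J) (cond_pmf \<phi> {S. J \<subseteq> S}) = det_process (?F - J) W"
      if "n < p \<and> measure_pmf.prob \<phi> {S. J \<subseteq> S} > 0"
      using that conditioned_on_inclusion[OF F XW J _ Wsub] X card by (simp add: law)
    show "cond_pmf \<phi> {S. J \<subseteq> ?F - S} = det_process (?F - J) (V @ W)"
      if *: "N - p > n \<and> measure_pmf.prob \<phi> {S. J \<subseteq> ?F - S} > 0"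
    proof -
      have pn: "p + n \<le> N" using * by (intro small) blast
      show ?thesis
        unfolding law
        by (rule conditioned_on_exclusion[OF F XW VW lenVW[OF pn] scale[OF pn] _ J])
           (use * in \<open>simp_all add: law\<close>)
    qed
    show "measure_pmf.prob (det_process (?F - J) W) {S. K \<subseteq> S} \<le> measure_pmf.prob \<phi> {S. K \<subseteq> S}"
      if "K \<subseteq> ?F - J" for K
      unfolding law by (rule inclusion_prob_append_mono[OF F XW Wsub _ that]) simp
    show "measure_pmf.prob \<phi> {S. K \<subseteq> S}
        \<le> measure_pmf.prob (det_process (?F - J) (V @ W)) {S. K \<subseteq> S}"
      if pos: "measure_pmf.prob \<phi> {S. J \<subseteq> ?F - S} > 0" and K: "K \<subseteq> ?F - J" for K
      unfolding law
      by (rule inclusion_prob_scale_mono[OF F XW VW _ lenVW[OF small[OF pos]] scale[OF small[OF pos]] a_le K]) simp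
  qed
qed

end
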